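(* Let $\rho,\delta\in(0,1)$, $C_g=1+\sqrt{2\rho/n}$, $\Omega\ge 1$, $w(\Omega)=3\sqrt\Omega$, and let $T$ be a positive integer. Let $\mathcal{P}^i=\mathcal{P}_{\delta,n,\rho}$ for every $i\in[m]$. Given a sequence $\{x_t\}_{t=1}^T$ with $x_t\in X$ for all $t\in[T]$, let $\{p_t^i\}_{t=1}^T$ be the sequence generated by the Bandit Mirror Descent update (defined in the context) with diminishing step size $\alpha_{p,t}=c_p/\sqrt t$, where $$c_p=\frac{2\delta}{C_g\cdot M^i\cdot n^2}\sqrt{\frac{\rho}{\Omega}},$$ and let $\theta\in\Delta_T$ be the normalization of $\{\alpha_{p,t}\}_{t=1}^T$, i.e. $\theta_t=\alpha_{p,t}/\sum_{s=1}^T\alpha_{p,s}$. Then, for all $i\in[m]$, $$\mathbb{P}\Big\{\epsilon^{i}\le\frac{w(\Omega)\cdot 2C_g\cdot M^i\cdot\ln(T)\cdot\sqrt{2\rho}}{\delta\sqrt T}\Big\}\ge 1-2\exp(-\Omega).$$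
   Context: Setting: $[m]=\{1,\dots,m\}$; $\Delta_T$ is the standard unit simplex in $\mathbb{R}^T$. $X\subseteq\mathbb{R}^d$ is closed and convex. For each $i\in[m]$, $F_r^i:X\to\mathbb{R}$, $r\in[n]$, are convex $G$-Lipschitz functions with $|F_r^i(x)|\le M^i$ for all $x\in X$, where $M^i>0$; $\mathbf{F}^i(x)=(F_1^i(x),\dots,F_n^i(x))$. Ambiguity set: $\mathcal{P}_{\delta,n,\rho}=\{p\in\mathbb{R}^n: p\ge\frac{\delta}{n}\mathbb{1}_n,\ D_{\chi^2}(p\|\frac{\mathbb{1}_n}{n})\le\frac{\rho}{n}\}$, where $D_{\chi^2}(p\|q)=\sum_{r=1}^n\frac{q^{(r)}}{2}\big(\frac{p^{(r)}}{q^{(r)}}-1\big)^2$ and $\mathbb{1}_n$ is the all-ones vector (no constraint $\mathbb{1}_n^\top p=1$). Weighted regret: $$\epsilon^{i}=\sup_{p^i\in\mathcal{P}^i}\sum_{t=1}^T\theta_t(p^i)^\top\mathbf{F}^i(x_t)-\sum_{t=1}^T\theta_t(p_t^i)^\top\mathbf{F}^i(x_t).$$ Bandit Mirror Descent update: start from $p_1^i\in\mathcal{P}_{\delta,n,\rho}$. At iteration $t$, sample (afresh) an index $I_{p,t}^i\in[n]$ from the distribution $p_t^i/(\mathbb{1}_n^\top p_t^i)$; define $g_{p,t}^i\in\mathbb{R}^n$ by $g_{p,t}^{i,(r)}=\frac{(\mathbb{1}_n^\top p_t^i)F_r^i(x_t)}{p_t^{i,(r)}}$ if $r=I_{p,t}^i$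 and $0$ otherwise; set $w_{t+1}^i=p_t^i+\alpha_{p,t}g_{p,t}^i$; and let $p_{t+1}^i=\operatorname{argmin}_{p\in\mathcal{P}_{\delta,n,\rho}}\frac12\|p-w_{t+1}^i\|_2^2$.
   Formalization: The claim is proved for T ≥ 2 rather than every positive integer T: for T = 1 the bound is 0 since ln 1 = 0, and it fails, e.g. for n = m = 1, ρ = δ = 1/2, F = M = 1, p_1 = 1/2, where the regret is surely 3/2. *)

theory Defs
  imports "HOL-Probability.Probability"
begin

definition chi_square_div :: "real ^ 'n::finite \<Rightarrow> real ^ 'n \<Rightarrow> real" where
  "chi_square_div p q = (\<Sum>r\<in>UNIV. q $ r / 2 * (p $ r / q $ r - 1)\<^sup>2)"

text \<open>Here \<open>1\<close> is the all-ones vector. The elements need not sum to one.\<close>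

definition ambiguity_set :: "real \<Rightarrow> real \<Rightarrow> (real ^ 'n::finite) set" where
  "ambiguity_set \<delta> \<rho> =
    {p. (\<forall>r. \<delta> / real CARD('n) \<le> p $ r) \<and>
        chi_square_div p ((1 / real CARD('n)) *\<^sub>R 1) \<le> \<rho> / real CARD('n)}"

definition normalized_weight :: "(nat \<Rightarrow> real) \<Rightarrow> nat \<Rightarrow> nat \<Rightarrow> real" where
  "normalized_weight \<alpha> T t = \<alpha> t / (\<Sum>s=1..T. \<alpha> s)"

text \<open>Below, \<open>f\<close> is the vector-valued function \<open>x \<mapsto> (F\<^sub>1(x), \<dots>, F\<^sub>n(x))\<close>.\<close>

definition weighted_regret ::
  "(real ^ 'n::finite) set \<Rightarrow> ('a \<Rightarrow> real ^ 'n) \<Rightarrow> (nat \<Rightarrow> real) \<Rightarrow> nat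
    \<Rightarrow> (nat \<Rightarrow> 'a) \<Rightarrow> (nat \<Rightarrow> real ^ 'n) \<Rightarrow> real" where
  "weighted_regret P f \<theta> T x p =
    (SUP q\<in>P. \<Sum>t=1..T. \<theta> t * (q \<bullet> f (x t))) - (\<Sum>t=1..T. \<theta> t * (p t \<bullet> f (x t)))"

text \<open>\<open>y\<close> is the vector of function values and \<open>k\<close> the sampled index.\<close>

definition bandit_gradient :: "real ^ 'n::finite \<Rightarrow> real ^ 'n \<Rightarrow> 'n \<Rightarrow> real ^ 'n" where
  "bandit_gradient p y k = (\<chi> r. if r = k then (1 \<bullet> p) * y $ r / p $ r else 0)"

definition is_bandit_update ::
  "(real ^ 'n::finite) set \<Rightarrow> real \<Rightarrow> real ^ 'n \<Rightarrow> real ^ 'n \<Rightarrow> 'n \<Rightarrow> real ^ 'n \<Rightarrow> bool" where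
  "is_bandit_update P a p y k p' \<longleftrightarrow>
    (let w = p + a *\<^sub>R bandit_gradient p y k
     in is_arg_min (\<lambda>q. 1 / 2 * (norm (q - w))\<^sup>2) (\<lambda>q. q \<in> P) p')"

text \<open>Conditionally on the information \<open>G\<close>, the random index \<open>K\<close> has probability mass function
  \<open>\<pi>\<close>, which may itself be random.\<close>

definition has_conditional_pmf ::
  "'w measure \<Rightarrow> 'w measure \<Rightarrow> ('w \<Rightarrow> 'n) \<Rightarrow> ('w \<Rightarrow> 'n \<Rightarrow> real) \<Rightarrow> bool" where
  "has_conditional_pmf S G K \<pi> \<longleftrightarrow>
    (\<forall>r. AE \<omega> in S. real_cond_exp S G (indicator {\<omega> \<in> space S. K \<omega> = r}) \<omega> = \<pi> \<omega> r)"

text \<open>The \<open>\<sigma>\<close>-algebra \<open>H t\<close> is the information available just before the index of iteration \<open>t\<close> is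
  drawn, so the draw \<open>I t\<close> is measurable for \<open>H (Suc t)\<close> and is fresh given \<open>H t\<close>.
  The points \<open>x t\<close> may depend on earlier draws.\<close>

definition bandit_mirror_descent ::
  "'w measure \<Rightarrow> (nat \<Rightarrow> 'w measure) \<Rightarrow> (real ^ 'n::finite) set \<Rightarrow> ('a \<Rightarrow> real ^ 'n)
    \<Rightarrow> (nat \<Rightarrow> real) \<Rightarrow> nat \<Rightarrow> (nat \<Rightarrow> 'w \<Rightarrow> 'a) \<Rightarrow> (nat \<Rightarrow> 'w \<Rightarrow> 'n)
    \<Rightarrow> (nat \<Rightarrow> 'w \<Rightarrow> real ^ 'n) \<Rightarrow> bool" where
  "bandit_mirror_descent S H P f \<alpha> T x I p \<longleftrightarrow>
    (\<exists>p\<^sub>1\<in>P. \<forall>\<omega>\<in>space S. p 1 \<omega> = p\<^sub>1) \<and>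
    (\<forall>t\<in>{1..T}. I t \<in> measurable (H (Suc t)) (count_space UNIV) \<and>
       has_conditional_pmf S (H t) (I t) (\<lambda>\<omega> r. p t \<omega> $ r / (1 \<bullet> p t \<omega>))) \<and>
    (\<forall>t\<in>{1..<T}. \<forall>\<omega>\<in>space S.
       is_bandit_update P (\<alpha> t) (p t \<omega>) (f (x t \<omega>)) (I t \<omega>) (p (Suc t) \<omega>))"

end

theory Submission
  imports Defs
begin

text \<open>
  Multiplied by the total step size \<open>\<Sum>\<^sub>t \<alpha>\<^sub>t\<close>, the weighted regret against a fixed comparator \<open>q\<close> is
  \<open>\<Sum>\<^sub>t \<alpha>\<^sub>t \<langle>F(x\<^sub>t), q - p\<^sub>t\<rangle>\<close>. Were the sampled gradients \<open>g\<^sub>t\<close> equal to \<open>F(x\<^sub>t)\<close>, the usual telescoping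
  argument for projected gradient ascent (\<open>projected_ascent_regret\<close>) would bound this sum by half the
  squared diameter of the set plus half the sum of the squared step lengths. The error \<open>\<Sum>\<^sub>t \<alpha>\<^sub>t \<langle>F(x\<^sub>t) - g\<^sub>t, q - p\<^sub>t\<rangle>\<close>
  that remains has conditionally centred terms for a fixed \<open>q\<close>, but the regret takes the supremum over \<open>q\<close>
  after the random draws, so \<open>q\<close> may not be treated as deterministic.

  The remedy is a second, fictitious sequence \<open>v\<^sub>t\<close>: projected ascent started at \<open>p\<^sub>1\<close> and driven by the
  noise \<open>F(x\<^sub>t) - g\<^sub>t\<close> itself. Its regret bound controls \<open>\<Sum>\<^sub>t \<alpha>\<^sub>t \<langle>F(x\<^sub>t) - g\<^sub>t, q - v\<^sub>t\<rangle>\<close> for all \<open>q\<close> at once, and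
  what is left, \<open>\<Sum>\<^sub>t \<alpha>\<^sub>t \<langle>F(x\<^sub>t) - g\<^sub>t, v\<^sub>t - p\<^sub>t\<rangle>\<close>, no longer mentions \<open>q\<close> (\<open>ghost_iterate_regret\<close>). Both \<open>v\<^sub>t\<close>
  and \<open>p\<^sub>t\<close> are known before the draw of round \<open>t\<close>, and \<open>g\<^sub>t\<close> is conditionally unbiased, so this is a sum of
  bounded martingale differences, to which the Azuma-Hoeffding inequality (\<open>azuma_hoeffding_tail\<close>) applies.
  The outcome for an arbitrary closed convex set is \<open>bandit_mirror_descent_concentration\<close>.

  For the ambiguity set, measured in units of \<open>\<rho> / n\<^sup>2\<close>, the resulting bound is at most \<open>8 + 4 h + 8 \<surd>h\<close>
  where \<open>h = \<Sum>\<^sub>t 1/t \<le> 1 + ln T\<close>, while the claimed bound times the total step size is at least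
  \<open>16 ln T\<close>. This settles the case \<open>T \<ge> 16\<close>, with probability even \<open>1 - exp (- \<Omega>)\<close>. For \<open>T \<le> 16\<close> the claim
  holds with certainty: there \<open>ln T / \<surd>T \<ge> 1/3\<close>, and the Cauchy-Schwarz inequality in each round suffices
  (\<open>short_horizon_regret_le\<close>).
\<close>

section \<open>The Azuma-Hoeffding inequality\<close>

text \<open>This is Hoeffding's lemma for a fair sign: the logarithm of the exponential moment of a variable
  that is \<open>0\<close> or \<open>2x\<close> with probability one half each, shifted by its mean, is \<open>ln (cosh x)\<close>.\<close>

lemma cosh_le_exp_half_square: "cosh x \<le> exp (x\<^sup>2 / 2)" for x :: real
proof -
  have *: "cosh y \<le> exp (y\<^sup>2 / 2)" if "y \<ge> 0" for y :: real
  proof -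
    have pos: "0 < (1 + exp (2 * y)) / 2"
      by (simp add: add_pos_pos)
    have "cosh y = exp (- y) * ((1 + exp (2 * y)) / 2)"
      by (simp add: cosh_field_def field_simps flip: exp_add)
    also have "(1 + exp (2 * y)) / 2 = exp (ln ((1 + exp (2 * y)) / 2))"
      using pos by (simp only: exp_ln)
    also have "(1 + exp (2 * y)) / 2 = 1 + 1/2 * (exp (2 * y) - 1)"
      by (simp add: field_simps)
    also have "exp (- y) * exp (ln \<dots>) = exp (- (2 * y) * (1/2) + ln \<dots>)"
      by (simp only: exp_add[symmetric]) simp
    also have "\<dots> \<le> exp ((2 * y)\<^sup>2 / 8)"
      using Hoeffdings_lemma_aux[of "2 * y" "1/2"] that by simp
    finally show ?thesis by (simp add: power2_eq_square)
  qed
  show ?thesis using *[of "\<bar>x\<bar>"] by simp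
qed

text \<open>By convexity the exponential lies below its chord over \<open>[-b, b]\<close>. The point of writing the chord in this
  form is that it is affine in \<open>x\<close>, so that the linear term drops out under a conditional
  expectation that vanishes.\<close>

lemma exp_le_chord:
  fixes x b s :: real
  assumes "0 < b" "\<bar>x\<bar> \<le> b"
  shows "exp (s * x) \<le> cosh (s * b) + x / b * sinh (s * b)"
proof -
  define u where "u = (b - x) / (2 * b)"
  have u: "0 \<le> u" "u \<le> 1" "x = u * (- b) + (1 - u) * b"
    using assms by (auto simp: u_def field_simps abs_le_iff)
  have "convex_on UNIV (exp :: real \<Rightarrow> real)"
    using convex_on_exp[of 1] by simp
  from convex_onD[OF this, of "1 - u" "s * (- b)" "s * b"] u
  have "exp (u * (s * (- b)) + (1 - u) * (s * b)) \<le> u * exp (s * (- b)) + (1 - u) * exp (s * b)"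
    by simp
  moreover have "u * (s * (- b)) + (1 - u) * (s * b) = s * x"
    by (subst u(3)) (simp add: algebra_simps)
  moreover have "u * exp (s * (- b)) + (1 - u) * exp (s * b) = cosh (s * b) + x / b * sinh (s * b)"
    using assms by (simp add: u_def cosh_field_def sinh_field_def field_simps)
  ultimately show ?thesis by simp
qed

text \<open>Peel off the last difference: conditionally on the past it is centred, so the chord bound leaves the
  factor \<open>cosh (s b\<^sub>t) \<le> exp (s\<^sup>2 b\<^sub>t\<^sup>2 / 2)\<close>.\<close>

lemma azuma_hoeffding_exp_moment:
  fixes d :: "nat \<Rightarrow> 'w \<Rightarrow> real" and b :: "nat \<Rightarrow> real"
  assumes S: "prob_space S" and filtr: "filtration (space S) H" "\<And>t. subalgebra S (H t)"
    and meas: "\<And>t. t \<in> {1..T} \<Longrightarrow> d t \<in> borel_measurable (H (Suc t))"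
    and bound: "\<And>t \<omega>. t \<in> {1..T} \<Longrightarrow> \<omega> \<in> space S \<Longrightarrow> \<bar>d t \<omega>\<bar> \<le> b t"
    and b_pos: "\<And>t. t \<in> {1..T} \<Longrightarrow> 0 < b t"
    and mart: "\<And>t. t \<in> {1..T} \<Longrightarrow> AE \<omega> in S. real_cond_exp S (H t) (d t) \<omega> = 0"
  shows "integrable S (\<lambda>\<omega>. exp (s * (\<Sum>t=1..T. d t \<omega>)))"
    and "(\<integral>\<omega>. exp (s * (\<Sum>t=1..T. d t \<omega>)) \<partial>S) \<le> exp (s\<^sup>2 / 2 * (\<Sum>t=1..T. (b t)\<^sup>2))"
proof -
  interpret prob_space S by fact
  interpret filtration "space S" H by fact
  have meas': "d t \<in> borel_measurable (H k)" if "t \<in> {1..T}" "t < k" for t k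
    using meas[OF that(1)] sets_F_mono[of "Suc t" k] that(2) filtr(2)[of "Suc t"] filtr(2)[of k]
    by (auto simp: subalgebra_def intro: measurable_from_subalg[of "H k" "H (Suc t)"])
  have measS: "d t \<in> borel_measurable S" if "t \<in> {1..T}" for t
    using measurable_from_subalg[OF filtr(2) meas[OF that]] .
  let ?Z = "\<lambda>n \<omega>. exp (s * (\<Sum>t=1..n. d t \<omega>))"
  have Zmeas: "?Z n \<in> borel_measurable (H (Suc n))" if "n \<le> T" for n
    using that by (intro measurable_compose[OF _ borel_measurable_exp] borel_measurable_times
        borel_measurable_const borel_measurable_sum meas') auto
  have ZmeasS: "?Z n \<in> borel_measurable S" if "n \<le> T" for n
    using measurable_from_subalg[OF filtr(2) Zmeas[OF that]] .
  have Zbound: "?Z n \<omega> \<le> exp (\<bar>s\<bar> * (\<Sum>t=1..n. b t))" if "n \<le> T" "\<omega> \<in> space S" for n \<omega>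
  proof -
    have "\<bar>\<Sum>t=1..n. d t \<omega>\<bar> \<le> (\<Sum>t=1..n. b t)"
      using that by (intro order_trans[OF sum_abs] sum_mono bound) auto
    then have "\<bar>s\<bar> * \<bar>\<Sum>t=1..n. d t \<omega>\<bar> \<le> \<bar>s\<bar> * (\<Sum>t=1..n. b t)"
      by (intro mult_left_mono) auto
    moreover have "s * (\<Sum>t=1..n. d t \<omega>) \<le> \<bar>s\<bar> * \<bar>\<Sum>t=1..n. d t \<omega>\<bar>"
      by (metis abs_ge_self abs_mult)
    ultimately show ?thesis by simp
  qed
  have Zint: "integrable S (?Z n)" if "n \<le> T" for n
    using Zbound[OF that] ZmeasS[OF that]
    by (intro integrable_const_bound[where B = "exp (\<bar>s\<bar> * (\<Sum>t=1..n. b t))"]) auto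
  then show "integrable S (?Z T)" by simp
  have "(\<integral>\<omega>. ?Z n \<omega> \<partial>S) \<le> exp (s\<^sup>2 / 2 * (\<Sum>t=1..n. (b t)\<^sup>2))" if "n \<le> T" for n
    using that
  proof (induction n)
    case 0
    show ?case by (simp add: prob_space)
  next
    case (Suc n)
    then have n: "n \<le> T" "Suc n \<in> {1..T}" by auto
    interpret sub: finite_measure_subalgebra S "H (Suc n)"
      by unfold_locales (rule filtr(2))
    have dint: "integrable S (\<lambda>\<omega>. ?Z n \<omega> * d (Suc n) \<omega>)"
    proof (rule integrable_const_bound)
      show "AE \<omega> in S. norm (?Z n \<omega> * d (Suc n) \<omega>) \<le> exp (\<bar>s\<bar> * (\<Sum>t=1..n. b t)) * b (Suc n)"
        using bound[OF n(2)] Zbound[OF n(1)]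
        by (intro AE_I2, unfold real_norm_def abs_mult abs_exp_cancel) (intro mult_mono; simp)
    qed (use ZmeasS[OF n(1)] measS[OF n(2)] in measurable)
    \<comment> \<open>The factor \<open>?Z n\<close> is known before round \<open>n + 1\<close>, so it may be moved into the conditional expectation.\<close>
    have "(\<integral>\<omega>. ?Z n \<omega> * d (Suc n) \<omega> \<partial>S) =
        (\<integral>\<omega>. ?Z n \<omega> * real_cond_exp S (H (Suc n)) (d (Suc n)) \<omega> \<partial>S)"
      using sub.real_cond_exp_intg(2)[OF dint Zmeas[OF n(1)] measS[OF n(2)]] by simp
    also have "\<dots> = (\<integral>\<omega>. 0 \<partial>S)"
    proof (rule integral_cong_AE)
      show "AE \<omega> in S. ?Z n \<omega> * real_cond_exp S (H (Suc n)) (d (Suc n)) \<omega> = 0"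
        using mart[OF n(2)] by auto
    qed (use ZmeasS[OF n(1)] in measurable)
    finally have zero: "(\<integral>\<omega>. ?Z n \<omega> * d (Suc n) \<omega> \<partial>S) = 0" by simp
    let ?c = "cosh (s * b (Suc n))" and ?k = "sinh (s * b (Suc n)) / b (Suc n)"
    have "(\<integral>\<omega>. ?Z (Suc n) \<omega> \<partial>S) \<le> (\<integral>\<omega>. ?c * ?Z n \<omega> + ?k * (?Z n \<omega> * d (Suc n) \<omega>) \<partial>S)"
    proof (rule integral_mono)
      show "integrable S (\<lambda>\<omega>. ?c * ?Z n \<omega> + ?k * (?Z n \<omega> * d (Suc n) \<omega>))"
        using Zint[OF n(1)] dint by auto
      fix \<omega> assume \<omega>: "\<omega> \<in> space S"
      have "?Z (Suc n) \<omega> = ?Z n \<omega> * exp (s * d (Suc n) \<omega>)"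
        by (simp add: ring_distribs exp_add)
      also have "\<dots> \<le> ?Z n \<omega> * (?c + d (Suc n) \<omega> / b (Suc n) * sinh (s * b (Suc n)))"
        by (intro mult_left_mono exp_le_chord b_pos[OF n(2)] bound[OF n(2) \<omega>]) auto
      finally show "?Z (Suc n) \<omega> \<le> ?c * ?Z n \<omega> + ?k * (?Z n \<omega> * d (Suc n) \<omega>)"
        by (simp add: algebra_simps)
    qed (rule Zint[OF Suc.prems])
    also have "\<dots> = ?c * (\<integral>\<omega>. ?Z n \<omega> \<partial>S)"
      using Zint[OF n(1)] dint zero by simp
    also have "\<dots> \<le> exp ((s * b (Suc n))\<^sup>2 / 2) * exp (s\<^sup>2 / 2 * (\<Sum>t=1..n. (b t)\<^sup>2))"
      by (intro mult_mono cosh_le_exp_half_square Suc.IH n(1)) auto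
    also have "\<dots> = exp (s\<^sup>2 / 2 * (\<Sum>t=1..Suc n. (b t)\<^sup>2))"
      by (simp add: power_mult_distrib ring_distribs exp_add mult.commute)
    finally show ?case .
  qed
  then show "(\<integral>\<omega>. ?Z T \<omega> \<partial>S) \<le> exp (s\<^sup>2 / 2 * (\<Sum>t=1..T. (b t)\<^sup>2))" by simp
qed

text \<open>The threshold \<open>r\<close> is the one at which the optimised Chernoff bound \<open>exp (- r\<^sup>2 / (2 \<Sum>\<^sub>t b\<^sub>t\<^sup>2))\<close> equals
  \<open>exp (- \<Omega>)\<close>.\<close>

lemma azuma_hoeffding_tail:
  fixes d :: "nat \<Rightarrow> 'w \<Rightarrow> real" and b :: "nat \<Rightarrow> real"
  assumes S: "prob_space S" and filtr: "filtration (space S) H" "\<And>t. subalgebra S (H t)"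
    and meas: "\<And>t. t \<in> {1..T} \<Longrightarrow> d t \<in> borel_measurable (H (Suc t))"
    and bound: "\<And>t \<omega>. t \<in> {1..T} \<Longrightarrow> \<omega> \<in> space S \<Longrightarrow> \<bar>d t \<omega>\<bar> \<le> b t"
    and b_pos: "\<And>t. t \<in> {1..T} \<Longrightarrow> 0 < b t"
    and mart: "\<And>t. t \<in> {1..T} \<Longrightarrow> AE \<omega> in S. real_cond_exp S (H t) (d t) \<omega> = 0"
    and "0 < T" "0 < \<Omega>"
  defines "r \<equiv> sqrt (2 * \<Omega> * (\<Sum>t=1..T. (b t)\<^sup>2))"
  shows "1 - exp (- \<Omega>) \<le> measure S {\<omega> \<in> space S. (\<Sum>t=1..T. d t \<omega>) \<le> r}"
proof -
  interpret prob_space S by fact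
  define V where "V = (\<Sum>t=1..T. (b t)\<^sup>2)"
  have V: "V > 0"
    unfolding V_def using b_pos \<open>0 < T\<close> by (intro sum_pos zero_less_power) auto
  \<comment> \<open>the minimiser of \<open>- s r + s\<^sup>2 V / 2\<close>\<close>
  define s where "s = r / V"
  have r: "r > 0" "r\<^sup>2 = 2 * \<Omega> * V"
    using V \<open>0 < \<Omega>\<close> unfolding r_def V_def[symmetric] by simp_all
  have s: "s > 0"
    using r(1) V by (simp add: s_def)
  note moment = azuma_hoeffding_exp_moment[OF S filtr meas bound b_pos mart, of T s]
  have dS: "d t \<in> borel_measurable S" if "t \<in> {1..T}" for t
    using measurable_from_subalg[OF filtr(2) meas[OF that]] .
  have [measurable]: "(\<lambda>\<omega>. \<Sum>t=1..T. d t \<omega>) \<in> borel_measurable S"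
    by (intro borel_measurable_sum dS)
  let ?M = "\<lambda>\<omega>. \<Sum>t=1..T. d t \<omega>"
  have "prob {\<omega>\<in>space S. ?M \<omega> \<ge> r} \<le> exp (- s * r) * (\<integral>\<omega>\<in>space S. exp (s * ?M \<omega>) \<partial>S)"
    using moment(1) by (intro Chernoff_ineq_ge s) (auto simp only: set_integrable_def sets.top intro!: integrable_mult_indicator)
  also have "(\<integral>\<omega>\<in>space S. exp (s * ?M \<omega>) \<partial>S) = (\<integral>\<omega>. exp (s * ?M \<omega>) \<partial>S)"
    using moment(1) by (intro set_integral_space)
  also have "exp (- s * r) * \<dots> \<le> exp (- s * r) * exp (s\<^sup>2 / 2 * V)"
    using moment(2) by (intro mult_left_mono) (simp_all add: V_def)
  also have "\<dots> = exp (- \<Omega>)"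
  proof -
    have "- s * r + s\<^sup>2 / 2 * V = - (r\<^sup>2 / (2 * V))"
      using V by (simp add: s_def field_simps power2_eq_square)
    also have "\<dots> = - \<Omega>"
      using r(2) V by simp
    finally show ?thesis by (metis exp_add)
  qed
  finally have "prob {\<omega>\<in>space S. ?M \<omega> \<ge> r} \<le> exp (- \<Omega>)" .
  moreover have "prob (space S - {\<omega>\<in>space S. ?M \<omega> \<ge> r}) = 1 - prob {\<omega>\<in>space S. ?M \<omega> \<ge> r}"
    by (rule prob_compl) measurable
  moreover have "prob (space S - {\<omega>\<in>space S. ?M \<omega> \<ge> r}) \<le> prob {\<omega>\<in>space S. ?M \<omega> \<le> r}"
    by (rule finite_measure_mono, force) measurable
  ultimately show ?thesis by linarith
qed

section \<open>Regret of projected ascent\<close>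

text \<open>Seen from the projection \<open>p'\<close>, the unprojected point \<open>p + u\<close> and any point of the set enclose an angle that
  is not acute. The cross term between \<open>u\<close> and \<open>p' - p\<close> is absorbed by completing the square.\<close>

lemma projected_ascent_step:
  fixes P :: "'a::euclidean_space set"
  assumes "convex P" "closed P" "q \<in> P" and p': "p' = closest_point P (p + u)"
  shows "u \<bullet> (q - p) \<le> (norm (q - p))\<^sup>2 / 2 - (norm (q - p'))\<^sup>2 / 2 + (norm u)\<^sup>2 / 2"
proof -
  have "(p + u - p') \<bullet> (q - p') \<le> 0"
    unfolding p' using assms(1-3) by (rule closest_point_dot)
  moreover have "0 \<le> (norm (p' - p - u))\<^sup>2" by simp
  ultimately show ?thesis
    unfolding power2_norm_eq_inner inner_simps add_divide_distrib diff_divide_distrib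
    using inner_commute[of p p'] inner_commute[of p q] inner_commute[of p' q]
      inner_commute[of u p] inner_commute[of u p'] inner_commute[of u q]
    by linarith
qed

text \<open>The squared distances to the comparator telescope. The update is only demanded up to the last round
  \<open>T\<close>; the final distance is nonnegative for whatever point would come next.\<close>

lemma projected_ascent_regret:
  fixes P :: "'a::euclidean_space set"
  assumes P: "convex P" "closed P" "q \<in> P" and "1 \<le> T"
    and step: "\<And>t. t \<in> {1..<T} \<Longrightarrow> p (Suc t) = closest_point P (p t + u t)"
  shows "(\<Sum>t=1..T. u t \<bullet> (q - p t)) \<le> (norm (q - p 1))\<^sup>2 / 2 + (\<Sum>t=1..T. (norm (u t))\<^sup>2) / 2"
proof -
  have *: "(\<Sum>t=1..n. u t \<bullet> (q - p t))
      \<le> (norm (q - p 1))\<^sup>2 / 2 - (norm (q - p (Suc n)))\<^sup>2 / 2 + (\<Sum>t=1..n. (norm (u t))\<^sup>2) / 2"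
    if "n < T" for n
    using that
  proof (induction n)
    case (Suc n)
    then have "p (Suc (Suc n)) = closest_point P (p (Suc n) + u (Suc n))"
      by (intro step) auto
    from projected_ascent_step[OF P this] Suc show ?case
      by (simp add: add_divide_distrib)
  qed simp
  obtain n where n: "T = Suc n" using \<open>1 \<le> T\<close> by (cases T) auto
  have "u T \<bullet> (q - p T) \<le> (norm (q - p T))\<^sup>2 / 2 + (norm (u T))\<^sup>2 / 2"
    using projected_ascent_step[OF P refl, where p = "p T" and u = "u T"]
    by (rule order_trans) simp
  with *[of n] show ?thesis
    unfolding n by (simp add: add_divide_distrib)
qed

text \<open>Here \<open>p\<close> follows the observed steps \<open>u\<close>, whereas the regret is measured with the true steps \<open>z\<close>. The ghost
  sequence \<open>v\<close> follows the difference \<open>z - u\<close>. Splitting \<open>z\<bullet>(q - p)\<close> into \<open>u\<bullet>(q - p)\<close>, \<open>(z - u)\<bullet>(q - v)\<close>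
  and \<open>(z - u)\<bullet>(v - p)\<close>, the first two are regrets of projected ascent, and the third is free of the
  comparator \<open>q\<close>.\<close>

lemma ghost_iterate_regret:
  fixes P :: "'a::euclidean_space set"
  assumes P: "convex P" "closed P" "q \<in> P" and "1 \<le> T"
    and p: "\<And>t. t \<in> {1..<T} \<Longrightarrow> p (Suc t) = closest_point P (p t + u t)"
    and v: "\<And>t. t \<in> {1..<T} \<Longrightarrow> v (Suc t) = closest_point P (v t + (z t - u t))"
  shows "(\<Sum>t=1..T. z t \<bullet> (q - p t))
    \<le> ((norm (q - p 1))\<^sup>2 + (norm (q - v 1))\<^sup>2) / 2
      + (\<Sum>t=1..T. (norm (u t))\<^sup>2 + (norm (z t - u t))\<^sup>2) / 2
      + (\<Sum>t=1..T. (z t - u t) \<bullet> (v t - p t))"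
proof -
  have "(\<Sum>t=1..T. z t \<bullet> (q - p t)) = (\<Sum>t=1..T. u t \<bullet> (q - p t)) + (\<Sum>t=1..T. (z t - u t) \<bullet> (q - v t))
      + (\<Sum>t=1..T. (z t - u t) \<bullet> (v t - p t))"
    unfolding sum.distrib[symmetric] by (intro sum.cong refl) (simp add: inner_simps)
  with projected_ascent_regret[where p=p and u=u, OF P \<open>1 \<le> T\<close> p]
    projected_ascent_regret[where p=v and u="\<lambda>t. z t - u t", OF P \<open>1 \<le> T\<close> v]
  show ?thesis by (simp add: sum.distrib add_divide_distrib)
qed

section \<open>Geometry of the ambiguity set\<close>

lemma chi_square_div_uniform:
  fixes p :: "real ^ 'n::finite"
  shows "chi_square_div p ((1 / real CARD('n)) *\<^sub>R 1)
    = real CARD('n) / 2 * (norm (p - (1 / real CARD('n)) *\<^sub>R 1))\<^sup>2"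
  unfolding chi_square_div_def power2_norm_eq_inner inner_vec_def
  by (auto simp: sum_distrib_left power2_eq_square field_simps intro!: sum.cong)

text \<open>Against the uniform vector the divergence is a multiple of the squared Euclidean distance, so the ambiguity
  set is a ball cut by half-spaces. Convexity, closedness and the diameter are read off from this.\<close>

lemma ambiguity_set_eq:
  "ambiguity_set \<delta> \<rho> = {p :: real ^ 'n::finite. \<forall>r. \<delta> / real CARD('n) \<le> p $ r}
    \<inter> cball ((1 / real CARD('n)) *\<^sub>R 1) (sqrt (2 * \<rho>) / real CARD('n))" if "0 < \<rho>"
proof -
  have "chi_square_div p ((1 / real CARD('n)) *\<^sub>R 1) \<le> \<rho> / real CARD('n) \<longleftrightarrow>
      p \<in> cball ((1 / real CARD('n)) *\<^sub>R 1) (sqrt (2 * \<rho>) / real CARD('n))" for p :: "real ^ 'n"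
  proof -
    define N where "N = real CARD('n)"
    define D where "D = norm (p - (1 / N) *\<^sub>R 1)"
    have N: "N > 0" by (simp add: N_def)
    have "N / 2 * D\<^sup>2 \<le> \<rho> / N \<longleftrightarrow> D\<^sup>2 \<le> (sqrt (2 * \<rho>) / N)\<^sup>2"
      using N that by (simp add: power_divide field_simps power2_eq_square)
    also have "\<dots> \<longleftrightarrow> D \<le> sqrt (2 * \<rho>) / N"
      using N that by (intro power_mono_iff) (auto simp: D_def)
    finally show ?thesis
      by (simp add: chi_square_div_uniform D_def N_def dist_norm norm_minus_commute)
  qed
  then show ?thesis by (auto simp: ambiguity_set_def)
qed

lemma convex_ambiguity_set:
  assumes "0 < \<rho>"
  shows "convex (ambiguity_set \<delta> \<rho> :: (real ^ 'n::finite) set)"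
proof -
  have "{p :: real ^ 'n. \<forall>r. \<delta> / real CARD('n) \<le> p $ r} = (\<Inter>r. {p. axis r 1 \<bullet> p \<ge> \<delta> / real CARD('n)})"
    by (auto simp: inner_axis inner_commute)
  then show ?thesis
    unfolding ambiguity_set_eq[OF assms] by (auto intro!: convex_Int convex_INT convex_halfspace_ge)
qed

lemma closed_ambiguity_set: "closed (ambiguity_set \<delta> \<rho>)"  if "0 < \<rho>"
  unfolding ambiguity_set_eq[OF that] Collect_all_eq
  by (intro closed_Int closed_INT closed_cball closed_Collect_le continuous_intros ballI)

lemma ambiguity_set_diameter:
  fixes p q :: "real ^ 'n::finite"
  assumes "0 < \<rho>" "p \<in> ambiguity_set \<delta> \<rho>" "q \<in> ambiguity_set \<delta> \<rho>"
  shows "norm (q - p) \<le> 2 * sqrt (2 * \<rho>) / real CARD('n)"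
proof -
  define c where "c = (1 / real CARD('n)) *\<^sub>R (1 :: real ^ 'n)"
  have "dist c p \<le> sqrt (2 * \<rho>) / real CARD('n)" "dist c q \<le> sqrt (2 * \<rho>) / real CARD('n)"
    using assms by (simp_all add: ambiguity_set_eq c_def)
  moreover have "norm (q - p) \<le> dist c q + dist c p"
    using dist_triangle3[of q p c] by (simp add: dist_norm)
  ultimately show ?thesis by simp
qed

lemma norm_one_vec: "norm (1 :: real ^ 'n::finite) = sqrt (real CARD('n))"
  by (simp add: norm_eq_sqrt_inner inner_vec_def)

text \<open>Cauchy-Schwarz against the all-ones vector, of norm \<open>\<surd>n\<close>, for the deviation from the uniform vector. This
  is the constant \<open>C\<^sub>g\<close> of the theorem.\<close>

lemma ambiguity_set_mass:
  fixes p :: "real ^ 'n::finite"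
  assumes "0 < \<rho>" "p \<in> ambiguity_set \<delta> \<rho>"
  shows "1 \<bullet> p \<le> 1 + sqrt (2 * \<rho> / real CARD('n))"
proof -
  define N where "N = real CARD('n)"
  have N: "N > 0" by (simp add: N_def)
  have "norm (p - (1 / N) *\<^sub>R 1) \<le> sqrt (2 * \<rho>) / N"
    using assms by (simp add: ambiguity_set_eq dist_norm N_def norm_minus_commute)
  then have "1 \<bullet> (p - (1 / N) *\<^sub>R 1) \<le> sqrt N * (sqrt (2 * \<rho>) / N)"
    using N by (intro order_trans[OF norm_cauchy_schwarz] mult_mono) (auto simp: norm_one_vec N_def)
  also have "\<dots> = sqrt (2 * \<rho> / N)"
    using N by (simp add: real_sqrt_divide real_div_sqrt field_simps)
  finally show ?thesis
    using N by (simp add: N_def inner_diff_right power2_norm_eq_inner[symmetric] norm_one_vec)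
qed

section \<open>The sampled gradient\<close>

lemma bandit_gradient_axis:
  "bandit_gradient p y k = ((1 \<bullet> p) * y $ k / p $ k) *\<^sub>R axis k 1"
  by (simp add: bandit_gradient_def vec_eq_iff axis_def)

lemma bandit_gradient_unbiased:
  fixes p y :: "real ^ 'n::finite"
  assumes "\<And>r. 0 < p $ r"
  shows "(\<Sum>k\<in>UNIV. (p $ k / (1 \<bullet> p)) *\<^sub>R bandit_gradient p y k) = y"
proof -
  have "0 < 1 \<bullet> p"
    using assms by (auto simp: inner_vec_def intro!: sum_pos)
  then have "(p $ k / (1 \<bullet> p)) *\<^sub>R bandit_gradient p y k = y $ k *s axis k 1" for k
    using assms[of k] by (simp add: bandit_gradient_axis scalar_mult_eq_scaleR)
  then show ?thesis by (simp add: basis_expansion)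
qed

text \<open>Both the gradient estimate and its error obey the same bound, which keeps the constants small. For the error,
  only the sampled coordinate is inflated, by \<open>a - 1\<close> with \<open>1 \<le> a \<le> B = C / \<eta>\<close>, while the other \<open>n - 1\<close>
  coordinates contribute at most \<open>M\<^sup>2\<close> each; since \<open>n \<le> B\<close>, also \<open>(B - 1)\<^sup>2 + n - 1 \<le> B\<^sup>2\<close>.\<close>

lemma bandit_gradient_norm_le:
  fixes p y :: "real ^ 'n::finite"
  assumes p: "\<And>r. \<eta> \<le> p $ r" "0 < \<eta>" and C: "1 \<bullet> p \<le> C" and y: "\<And>r. \<bar>y $ r\<bar> \<le> M"
  shows "norm (bandit_gradient p y k) \<le> C * M / \<eta>"
    and "norm (y - bandit_gradient p y k) \<le> C * M / \<eta>"
proof -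
  have M: "0 \<le> M" using y[of k] by linarith
  have pk: "0 < p $ k" using p order_less_le_trans by blast
  define a where "a = (1 \<bullet> p) / p $ k"
  have sum_ge: "real CARD('n) * \<eta> \<le> 1 \<bullet> p"
    using sum_mono[of UNIV "\<lambda>_. \<eta>" "\<lambda>r. p $ r"] p(1) by (simp add: inner_vec_def)
  have s0: "0 \<le> 1 \<bullet> p"
    using sum_ge p(2) by (meson mult_nonneg_nonneg of_nat_0_le_iff order_less_imp_le order_trans)
  have "p $ k \<le> 1 \<bullet> p"
    using member_le_sum[of k UNIV "\<lambda>r. p $ r"] p order_trans[of 0 \<eta>] by (simp add: inner_vec_def order_less_imp_le)
  then have a1: "1 \<le> a" using pk by (simp add: a_def)
  define B where "B = C / \<eta>"
  have aB: "a \<le> B"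
    unfolding a_def B_def using C s0 p by (intro frac_le) auto
  have nB: "real CARD('n) \<le> B"
    unfolding B_def using sum_ge C p(2) by (simp add: pos_le_divide_eq)
  have g: "bandit_gradient p y k = (a * y $ k) *\<^sub>R axis k 1"
    by (simp add: bandit_gradient_axis a_def)
  have "norm (bandit_gradient p y k) = a * \<bar>y $ k\<bar>"
    using a1 by (simp add: g abs_mult)
  also have "\<dots> \<le> B * M"
    using a1 aB y[of k] by (intro mult_mono) auto
  finally show "norm (bandit_gradient p y k) \<le> C * M / \<eta>" by (simp add: B_def)
  have ysq: "(y $ r)\<^sup>2 \<le> M\<^sup>2" for r
    using y[of r] M by (simp add: abs_le_square_iff[symmetric])
  have "(norm (y - bandit_gradient p y k))\<^sup>2 = (\<Sum>r\<in>UNIV. (y $ r - (if r = k then a * y $ k else 0))\<^sup>2)"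
    unfolding power2_norm_eq_inner inner_vec_def
    by (auto simp: power2_eq_square g axis_def intro!: sum.cong)
  also have "\<dots> = (y $ k - a * y $ k)\<^sup>2 + (\<Sum>r\<in>UNIV - {k}. (y $ r)\<^sup>2)"
    by (subst sum.remove[of _ k]) (auto intro!: sum.cong)
  also have "\<dots> = (a - 1)\<^sup>2 * (y $ k)\<^sup>2 + (\<Sum>r\<in>UNIV - {k}. (y $ r)\<^sup>2)"
    by algebra
  also have "\<dots> \<le> (B - 1)\<^sup>2 * M\<^sup>2 + (\<Sum>r\<in>UNIV - {k}. M\<^sup>2)"
    using a1 aB by (intro add_mono mult_mono sum_mono ysq power_mono) auto
  also have "\<dots> = ((B - 1)\<^sup>2 + (real CARD('n) - 1)) * M\<^sup>2"
    by (simp add: of_nat_diff distrib_right)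
  also have "\<dots> \<le> B\<^sup>2 * M\<^sup>2"
  proof (rule mult_right_mono)
    have "(B - 1)\<^sup>2 = B\<^sup>2 - 2 * B + 1"
      by (simp add: power2_diff)
    then show "(B - 1)\<^sup>2 + (real CARD('n) - 1) \<le> B\<^sup>2"
      using nB a1 aB by linarith
  qed simp
  also have "\<dots> = (B * M)\<^sup>2" by (simp add: power_mult_distrib)
  finally have "(norm (y - bandit_gradient p y k))\<^sup>2 \<le> (B * M)\<^sup>2" .
  moreover have "0 \<le> B * M"
    using M a1 aB by (intro mult_nonneg_nonneg) linarith+
  ultimately have "norm (y - bandit_gradient p y k) \<le> B * M"
    by (rule power2_le_imp_le)
  then show "norm (y - bandit_gradient p y k) \<le> C * M / \<eta>"
    by (simp add: B_def)
qed

lemma is_bandit_update_closest_point: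
  assumes "convex P" "closed P" "is_bandit_update P a p y k p'"
  shows "p' = closest_point P (p + a *\<^sub>R bandit_gradient p y k)"
proof (rule closest_point_unique[OF assms(1,2)])
  let ?w = "p + a *\<^sub>R bandit_gradient p y k"
  show "p' \<in> P"
    using assms(3) by (simp add: is_bandit_update_def is_arg_min_def Let_def)
  show "\<forall>z\<in>P. dist ?w p' \<le> dist ?w z"
  proof
    fix z assume "z \<in> P"
    then have "(norm (p' - ?w))\<^sup>2 \<le> (norm (z - ?w))\<^sup>2"
      using assms(3) by (simp add: is_bandit_update_def is_arg_min_linorder Let_def)
    then have "norm (p' - ?w) \<le> norm (z - ?w)"
      by (rule power2_le_imp_le) simp
    then show "dist ?w p' \<le> dist ?w z"
      by (simp only: dist_norm norm_minus_commute[of ?w])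
  qed
qed

text \<open>The sampled index takes finitely many values, so measurability may be checked for each fixed index.\<close>

lemma borel_measurable_bandit_gradient:
  fixes p y :: "'w \<Rightarrow> real ^ 'n::finite"
  assumes [measurable]: "p \<in> borel_measurable N" "y \<in> borel_measurable N"
    and K: "K \<in> measurable N (count_space UNIV)"
  shows "(\<lambda>\<omega>. bandit_gradient (p \<omega>) (y \<omega>) (K \<omega>)) \<in> borel_measurable N"
proof (rule measurable_compose_countable[OF _ K])
  fix k
  have nth: "z $ k = z \<bullet> axis k 1" for z :: "real ^ 'n"
    by (simp add: inner_axis)
  show "(\<lambda>\<omega>. bandit_gradient (p \<omega>) (y \<omega>) k) \<in> borel_measurable N"
    unfolding bandit_gradient_axis nth by measurable
qed

text \<open>Splitting over the values of the sampled index reduces the conditional expectation to the unbiasedness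
  of the estimate under the sampling distribution. The direction \<open>z\<close> may be random as long as it is known
  before the draw.\<close>

lemma bandit_gradient_cond_exp:
  fixes p y z :: "'w \<Rightarrow> real ^ 'n::finite"
  assumes S: "prob_space S" and G: "subalgebra S G"
    and meas [measurable]: "p \<in> borel_measurable G" "y \<in> borel_measurable G" "z \<in> borel_measurable G"
    and K: "K \<in> measurable S (count_space UNIV)"
    and pmf: "has_conditional_pmf S G K (\<lambda>\<omega> r. p \<omega> $ r / (1 \<bullet> p \<omega>))"
    and p: "\<And>\<omega> r. \<omega> \<in> space S \<Longrightarrow> \<eta> \<le> p \<omega> $ r" "0 < \<eta>" "\<And>\<omega>. \<omega> \<in> space S \<Longrightarrow> 1 \<bullet> p \<omega> \<le> C"
    and y: "\<And>\<omega> r. \<omega> \<in> space S \<Longrightarrow> \<bar>y \<omega> $ r\<bar> \<le> M"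
    and z: "\<And>\<omega>. \<omega> \<in> space S \<Longrightarrow> norm (z \<omega>) \<le> R"
  shows "AE \<omega> in S. real_cond_exp S G
      (\<lambda>\<omega>. (y \<omega> - bandit_gradient (p \<omega>) (y \<omega>) (K \<omega>)) \<bullet> z \<omega>) \<omega> = 0"
proof -
  interpret prob_space S by fact
  interpret finite_measure_subalgebra S G by unfold_locales (rule G)
  define D where "D r \<omega> = (y \<omega> - bandit_gradient (p \<omega>) (y \<omega>) r) \<bullet> z \<omega>" for r \<omega>
  let ?K = "\<lambda>r. indicator {\<omega> \<in> space S. K \<omega> = r} :: 'w \<Rightarrow> real"
  have [measurable]: "D r \<in> borel_measurable G" for r
    unfolding D_def[abs_def] using borel_measurable_bandit_gradient[OF meas(1,2), of "\<lambda>_. r"] by measurable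
  have DS [measurable]: "D r \<in> borel_measurable S" for r
    by (rule measurable_from_subalg[OF G]) measurable
  have Kset [measurable]: "{\<omega> \<in> space S. K \<omega> = r} \<in> sets S" for r
    using measurable_sets[OF K, of "{r}"] by (simp add: vimage_def Int_def conj_commute)
  have int: "integrable S (\<lambda>\<omega>. D r \<omega> * ?K r \<omega>)" for r
  proof (rule integrable_const_bound)
    show "AE \<omega> in S. norm (D r \<omega> * ?K r \<omega>) \<le> C * M / \<eta> * R"
    proof (rule AE_I2)
      fix \<omega> assume \<omega>: "\<omega> \<in> space S"
      have "norm (D r \<omega> * ?K r \<omega>) \<le> \<bar>D r \<omega>\<bar>"
        by (simp add: indicator_def)
      also have "\<dots> \<le> norm (y \<omega> - bandit_gradient (p \<omega>) (y \<omega>) r) * norm (z \<omega>)"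
        unfolding D_def by (rule Cauchy_Schwarz_ineq2)
      also have "\<dots> \<le> C * M / \<eta> * R"
        using bandit_gradient_norm_le(2)[OF p(1)[OF \<omega>] p(2) p(3)[OF \<omega>] y[OF \<omega>]]
          order_trans[OF norm_ge_zero bandit_gradient_norm_le(2)[OF p(1)[OF \<omega>] p(2) p(3)[OF \<omega>] y[OF \<omega>]]] z[OF \<omega>]
        by (intro mult_mono) auto
      finally show "norm (D r \<omega> * ?K r \<omega>) \<le> C * M / \<eta> * R" .
    qed
  qed measurable
  have split: "D (K \<omega>) \<omega> = (\<Sum>r\<in>UNIV. D r \<omega> * ?K r \<omega>)" if "\<omega> \<in> space S" for \<omega>
    using that by (simp add: indicator_def if_distrib sum.delta cong: if_cong)
  have "AE \<omega> in S. real_cond_exp S G (\<lambda>\<omega>. D (K \<omega>) \<omega>) \<omega> =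
      real_cond_exp S G (\<lambda>\<omega>. \<Sum>r\<in>UNIV. D r \<omega> * ?K r \<omega>) \<omega>"
  proof (rule real_cond_exp_cong)
    show "(\<lambda>\<omega>. D (K \<omega>) \<omega>) \<in> borel_measurable S"
      by (rule measurable_compose_countable[OF DS K])
    show "(\<lambda>\<omega>. \<Sum>r\<in>UNIV. D r \<omega> * ?K r \<omega>) \<in> borel_measurable S"
      by measurable
  qed (use split in auto)
  moreover have "AE \<omega> in S. real_cond_exp S G (\<lambda>\<omega>. \<Sum>r\<in>UNIV. D r \<omega> * ?K r \<omega>) \<omega> =
      (\<Sum>r\<in>UNIV. real_cond_exp S G (\<lambda>\<omega>. D r \<omega> * ?K r \<omega>) \<omega>)"
    by (rule real_cond_exp_sum[OF int])
  moreover have "AE \<omega> in S. \<forall>r. real_cond_exp S G (\<lambda>\<omega>. D r \<omega> * ?K r \<omega>) \<omega> = D r \<omega> * real_cond_exp S G (?K r) \<omega>"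
    by (subst AE_all_countable) (auto intro!: real_cond_exp_mult int)
  moreover have "AE \<omega> in S. \<forall>r. real_cond_exp S G (?K r) \<omega> = p \<omega> $ r / (1 \<bullet> p \<omega>)"
    using pmf by (subst AE_all_countable) (auto simp: has_conditional_pmf_def)
  ultimately have "AE \<omega> in S. real_cond_exp S G (\<lambda>\<omega>. D (K \<omega>) \<omega>) \<omega> = 0"
    using AE_space
  proof eventually_elim
    case (elim \<omega>)
    have pos: "0 < p \<omega> $ r" for r
      using p(1)[OF elim(5), of r] p(2) by linarith
    have s: "0 < 1 \<bullet> p \<omega>"
      using pos by (auto simp: inner_vec_def intro!: sum_pos)
    let ?\<pi> = "\<lambda>r. p \<omega> $ r / (1 \<bullet> p \<omega>)"
    have "(\<Sum>r\<in>UNIV. ?\<pi> r) = 1"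
      using s by (simp add: sum_divide_distrib[symmetric] inner_vec_def)
    then have y_avg: "(\<Sum>r\<in>UNIV. ?\<pi> r *\<^sub>R y \<omega>) = y \<omega>"
      by (simp only: scaleR_sum_left[symmetric] scaleR_one)
    have "real_cond_exp S G (\<lambda>\<omega>. D (K \<omega>) \<omega>) \<omega> = (\<Sum>r\<in>UNIV. D r \<omega> * ?\<pi> r)"
      using elim by simp
    also have "\<dots> = (\<Sum>r\<in>UNIV. ?\<pi> r *\<^sub>R (y \<omega> - bandit_gradient (p \<omega>) (y \<omega>) r)) \<bullet> z \<omega>"
      unfolding inner_sum_left by (intro sum.cong refl) (simp add: D_def)
    also have "(\<Sum>r\<in>UNIV. ?\<pi> r *\<^sub>R (y \<omega> - bandit_gradient (p \<omega>) (y \<omega>) r)) = y \<omega> - y \<omega>"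
      unfolding scaleR_diff_right sum_subtractf
      by (simp only: y_avg bandit_gradient_unbiased[OF pos])
    finally show ?case by simp
  qed
  then show ?thesis by (simp add: D_def)
qed

section \<open>Concentration for bandit mirror descent\<close>

text \<open>
  The regret event involves a supremum over uncountably many comparators. Its measurability follows because
  it is the preimage of this closed set, an intersection of closed half-spaces.\<close>

lemma closed_support_le:
  fixes P :: "'a::real_inner set"
  shows "closed {(z, c). \<forall>q\<in>P. q \<bullet> z - c \<le> (k :: real)}"
proof -
  have "{(z, c). \<forall>q\<in>P. q \<bullet> z - c \<le> k} = (\<Inter>q\<in>P. {w. q \<bullet> fst w - snd w \<le> k})"
    by auto
  then show ?thesis
    by (auto intro!: closed_INT closed_Collect_le continuous_intros)
qed

text \<open>The update is a continuous projection of quantities known after the draw of the current round.\<close>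

lemma bandit_mirror_descent_adapted:
  fixes P :: "(real ^ 'n::finite) set"
  assumes filtr: "filtration (space S) H"
    and P: "convex P" "closed P"
    and f: "\<And>t. t \<in> {1..T} \<Longrightarrow> (\<lambda>\<omega>. f (x t \<omega>)) \<in> borel_measurable (H t)"
    and bmd: "bandit_mirror_descent S H P f a T x I p"
    and t: "1 \<le> t" "t \<le> T"
  shows "p t \<in> borel_measurable (H t)" and "\<And>\<omega>. \<omega> \<in> space S \<Longrightarrow> p t \<omega> \<in> P"
proof -
  interpret filtration "space S" H by fact
  obtain p1 where p1: "p1 \<in> P" "\<And>\<omega>. \<omega> \<in> space S \<Longrightarrow> p 1 \<omega> = p1"
    using bmd by (auto simp: bandit_mirror_descent_def)
  have "p t \<in> borel_measurable (H t) \<and> (\<forall>\<omega>\<in>space S. p t \<omega> \<in> P)"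
    using t
  proof (induction t rule: dec_induct)
    case base
    have "p 1 \<in> borel_measurable (H 1) \<longleftrightarrow> (\<lambda>_. p1) \<in> borel_measurable (H 1)"
      by (rule measurable_cong) (simp only: p1(2) space_F)
    then show ?case using p1 by simp
  next
    case (step t)
    then have t: "t \<in> {1..<T}" "t \<in> {1..T}" and p [measurable]: "p t \<in> borel_measurable (H t)" by auto
    have mono: "g \<in> borel_measurable (H (Suc t))" if "g \<in> borel_measurable (H t)" for g :: "_ \<Rightarrow> real ^ 'n"
      using that sets_F_mono[of t "Suc t"] space_F
      by (auto intro: measurable_from_subalg[of "H (Suc t)" "H t"] simp: subalgebra_def)
    have upd: "p (Suc t) \<omega> = closest_point P (p t \<omega> + a t *\<^sub>R bandit_gradient (p t \<omega>) (f (x t \<omega>)) (I t \<omega>))"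
      if "\<omega> \<in> space S" for \<omega>
      using bmd t that by (intro is_bandit_update_closest_point[OF P]) (auto simp: bandit_mirror_descent_def)
    have I: "I t \<in> measurable (H (Suc t)) (count_space UNIV)"
      using bmd t by (auto simp: bandit_mirror_descent_def)
    have [measurable]: "(\<lambda>\<omega>. bandit_gradient (p t \<omega>) (f (x t \<omega>)) (I t \<omega>)) \<in> borel_measurable (H (Suc t))"
      by (intro borel_measurable_bandit_gradient mono p f t I)
    have [measurable]: "p t \<in> borel_measurable (H (Suc t))"
      by (rule mono[OF p])
    have "(\<lambda>\<omega>. closest_point P (p t \<omega> + a t *\<^sub>R bandit_gradient (p t \<omega>) (f (x t \<omega>)) (I t \<omega>)))
        \<in> borel_measurable (H (Suc t))"
      using p1(1) by (intro borel_measurable_continuous_on[OF continuous_on_closest_point[OF P]]) auto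
    then have "p (Suc t) \<in> borel_measurable (H (Suc t))"
      using upd by (subst measurable_cong) (auto simp: space_F)
    then show ?case
      using upd p1(1) P by (auto intro!: closest_point_in_set)
  qed
  then show "p t \<in> borel_measurable (H t)" and "\<And>\<omega>. \<omega> \<in> space S \<Longrightarrow> p t \<omega> \<in> P" by auto
qed

lemma bandit_mirror_descent_event_measurable:
  fixes P :: "(real ^ 'n::finite) set"
  assumes filtr: "filtration (space S) H" "\<And>t. subalgebra S (H t)"
    and P: "convex P" "closed P"
    and f: "\<And>t. t \<in> {1..T} \<Longrightarrow> (\<lambda>\<omega>. f (x t \<omega>)) \<in> borel_measurable (H t)"
    and bmd: "bandit_mirror_descent S H P f a T x I p"
  shows "{\<omega> \<in> space S. \<forall>q\<in>P. (\<Sum>t=1..T. b t * (f (x t \<omega>) \<bullet> (q - p t \<omega>))) \<le> k} \<in> sets S"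
proof -
  have fS [measurable]: "(\<lambda>\<omega>. f (x t \<omega>)) \<in> borel_measurable S" if "t \<in> {1..T}" for t
    using measurable_from_subalg[OF filtr(2) f[OF that]] .
  have pS [measurable]: "p t \<in> borel_measurable S" if "t \<in> {1..T}" for t
    using that measurable_from_subalg[OF filtr(2) bandit_mirror_descent_adapted(1)[OF filtr(1) P f bmd]] by auto
  let ?w = "\<lambda>\<omega>. (\<Sum>t=1..T. b t *\<^sub>R f (x t \<omega>), \<Sum>t=1..T. b t * (p t \<omega> \<bullet> f (x t \<omega>)))"
  have "?w \<in> borel_measurable S"
    using fS pS by (intro borel_measurable_Pair borel_measurable_sum) auto
  then have "?w -` {(z, c). \<forall>q\<in>P. q \<bullet> z - c \<le> k} \<inter> space S \<in> sets S"
    by (rule measurable_sets) (intro borel_closed closed_support_le)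
  also have "?w -` {(z, c). \<forall>q\<in>P. q \<bullet> z - c \<le> k} \<inter> space S =
      {\<omega> \<in> space S. \<forall>q\<in>P. (\<Sum>t=1..T. b t * (f (x t \<omega>) \<bullet> (q - p t \<omega>))) \<le> k}"
    by (auto simp: inner_sum_right inner_diff_right right_diff_distrib sum_subtractf inner_commute)
  finally show ?thesis .
qed

text \<open>The bound holds for all comparators simultaneously. Its three parts are half the squared diameter, once for
  the iterates and once for the ghost sequence; the squared step lengths, again from both
  sequences; and the Azuma-Hoeffding deviation with difference bounds \<open>a\<^sub>t L R\<close>.\<close>

theorem bandit_mirror_descent_concentration:
  fixes P :: "(real ^ 'n::finite) set"
  assumes S: "prob_space S" and filtr: "filtration (space S) H" "\<And>t. subalgebra S (H t)"
    and P: "convex P" "closed P"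
    and P_ge: "\<And>p r. p \<in> P \<Longrightarrow> \<eta> \<le> p $ r" "0 < \<eta>"
    and P_mass: "\<And>p. p \<in> P \<Longrightarrow> 1 \<bullet> p \<le> C"
    and P_diam: "\<And>p q. p \<in> P \<Longrightarrow> q \<in> P \<Longrightarrow> norm (q - p) \<le> R" "0 < R"
    and f: "\<And>t. t \<in> {1..T} \<Longrightarrow> (\<lambda>\<omega>. f (x t \<omega>)) \<in> borel_measurable (H t)"
    and f_le: "\<And>t \<omega> r. t \<in> {1..T} \<Longrightarrow> \<omega> \<in> space S \<Longrightarrow> \<bar>f (x t \<omega>) $ r\<bar> \<le> M" "0 < M"
    and a: "\<And>t. t \<in> {1..T} \<Longrightarrow> 0 < a t"
    and T: "1 \<le> T" and \<Omega>: "0 < \<Omega>"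
    and bmd: "bandit_mirror_descent S H P f a T x I p"
  defines "L \<equiv> C * M / \<eta>" and "A \<equiv> \<Sum>t=1..T. (a t)\<^sup>2"
  shows "1 - exp (- \<Omega>) \<le> measure S {\<omega> \<in> space S. \<forall>q\<in>P.
      (\<Sum>t=1..T. a t * (f (x t \<omega>) \<bullet> (q - p t \<omega>))) \<le> R\<^sup>2 + L\<^sup>2 * A + R * L * sqrt (2 * \<Omega> * A)}"
proof -
  interpret prob_space S by fact
  interpret filtration "space S" H by fact
  obtain p1 where p1: "p1 \<in> P" "\<And>\<omega>. \<omega> \<in> space S \<Longrightarrow> p 1 \<omega> = p1"
    using bmd by (auto simp: bandit_mirror_descent_def)
  have "0 < 1 \<bullet> p1"
    using P_ge order_less_le_trans[OF P_ge(2) P_ge(1)[OF p1(1)]] by (auto simp: inner_vec_def intro!: sum_pos)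
  then have L: "0 < L"
    using P_mass[OF p1(1)] P_ge(2) f_le(2) by (auto simp: L_def)
  define Y where "Y t \<omega> = f (x t \<omega>)" for t \<omega>
  define g where "g t \<omega> = bandit_gradient (p t \<omega>) (Y t \<omega>) (I t \<omega>)" for t \<omega>
  \<comment> \<open>the ghost sequence; index \<open>0\<close> is a dummy, so that round \<open>1\<close> starts at the same point as the iterates\<close>
  define v where "v = rec_nat (\<lambda>\<omega>. p1)
    (\<lambda>t vt \<omega>. if t = 0 then p1 else closest_point P (vt \<omega> + (a t *\<^sub>R Y t \<omega> - a t *\<^sub>R g t \<omega>)))"
  have v1: "v 1 \<omega> = p1" for \<omega>
    by (simp add: v_def)
  have v_Suc: "v (Suc t) \<omega> = closest_point P (v t \<omega> + (a t *\<^sub>R Y t \<omega> - a t *\<^sub>R g t \<omega>))"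
    if "t \<in> {1..<T}" for t \<omega>
    using that by (simp add: v_def)
  note adapted = bandit_mirror_descent_adapted[OF filtr(1) P f bmd]
  have mono: "h \<in> borel_measurable (H (Suc t))" if "h \<in> borel_measurable (H t)" for h :: "_ \<Rightarrow> real ^ 'n" and t
    using that sets_F_mono[of t "Suc t"] space_F
    by (auto intro: measurable_from_subalg[of "H (Suc t)" "H t"] simp: subalgebra_def)
  have Ym: "Y t \<in> borel_measurable (H t)" if "t \<in> {1..T}" for t
    using f[OF that] by (simp add: Y_def[abs_def])
  have pm: "p t \<in> borel_measurable (H t)" and pP: "\<omega> \<in> space S \<Longrightarrow> p t \<omega> \<in> P" if "t \<in> {1..T}" for t \<omega>
    using adapted[of t] that by auto
  have Im: "I t \<in> measurable (H (Suc t)) (count_space UNIV)" if "t \<in> {1..T}" for t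
    using bmd that by (auto simp: bandit_mirror_descent_def)
  have gm: "g t \<in> borel_measurable (H (Suc t))" if "t \<in> {1..T}" for t
    unfolding g_def[abs_def] using that
    by (intro borel_measurable_bandit_gradient mono pm Ym Im)
  have vP: "v t \<omega> \<in> P" for t \<omega>
    using p1(1) P by (cases t) (auto simp: v_def intro!: closest_point_in_set)
  have vm: "v t \<in> borel_measurable (H t)" if "1 \<le> t" "t \<le> T" for t
    using that
  proof (induction t rule: dec_induct)
    case base
    have "v 1 = (\<lambda>_. p1)" using v1 by auto
    then show ?case by (simp only: measurable_const space_borel UNIV_I)
  next
    case (step t)
    then have t: "t \<in> {1..<T}" "t \<in> {1..T}" by auto
    have [measurable]: "v t \<in> borel_measurable (H (Suc t))" "Y t \<in> borel_measurable (H (Suc t))"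
        "g t \<in> borel_measurable (H (Suc t))"
      using step t by (auto intro!: mono Ym gm)
    have "v (Suc t) = (\<lambda>\<omega>. closest_point P (v t \<omega> + (a t *\<^sub>R Y t \<omega> - a t *\<^sub>R g t \<omega>)))"
      using v_Suc[OF t(1)] by auto
    then show ?case
      using p1(1) by (auto intro!: borel_measurable_continuous_on[OF continuous_on_closest_point[OF P]])
  qed
  define d where "d t \<omega> = (a t *\<^sub>R Y t \<omega> - a t *\<^sub>R g t \<omega>) \<bullet> (v t \<omega> - p t \<omega>)" for t \<omega>
  have gL: "norm (g t \<omega>) \<le> L" "norm (Y t \<omega> - g t \<omega>) \<le> L" if "t \<in> {1..T}" "\<omega> \<in> space S" for t \<omega>
    unfolding g_def Y_def L_def using that pP[OF that]
    by (intro bandit_gradient_norm_le P_ge P_mass f_le; simp)+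
  have uL: "norm (a t *\<^sub>R g t \<omega>) \<le> a t * L" "norm (a t *\<^sub>R Y t \<omega> - a t *\<^sub>R g t \<omega>) \<le> a t * L"
    if "t \<in> {1..T}" "\<omega> \<in> space S" for t \<omega>
    using gL[OF that] a[OF that(1)] by (simp_all add: scaleR_diff_right[symmetric])
  have tail: "1 - exp (- \<Omega>) \<le> prob {\<omega> \<in> space S. (\<Sum>t=1..T. d t \<omega>) \<le> sqrt (2 * \<Omega> * (\<Sum>t=1..T. (a t * L * R)\<^sup>2))}"
  proof (rule azuma_hoeffding_tail[OF S filtr])
    fix t assume t: "t \<in> {1..T}"
    have [measurable]: "v t \<in> borel_measurable (H (Suc t))" "Y t \<in> borel_measurable (H (Suc t))"
        "g t \<in> borel_measurable (H (Suc t))" "p t \<in> borel_measurable (H (Suc t))"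
      using t by (auto intro!: mono Ym gm vm pm)
    show "d t \<in> borel_measurable (H (Suc t))"
      unfolding d_def[abs_def] by measurable
    show "0 < a t * L * R"
      using a[OF t] L P_diam(2) by simp
    show "\<bar>d t \<omega>\<bar> \<le> a t * L * R" if "\<omega> \<in> space S" for \<omega>
      unfolding d_def using uL(2)[OF t that] pP[OF t that] vP a[OF t] L
      by (intro order_trans[OF Cauchy_Schwarz_ineq2] mult_mono P_diam) auto
    have pmf: "has_conditional_pmf S (H t) (I t) (\<lambda>\<omega> r. p t \<omega> $ r / (1 \<bullet> p t \<omega>))"
      using bmd t by (auto simp: bandit_mirror_descent_def)
    have "AE \<omega> in S. real_cond_exp S (H t)
        (\<lambda>\<omega>. (Y t \<omega> - bandit_gradient (p t \<omega>) (Y t \<omega>) (I t \<omega>)) \<bullet> (a t *\<^sub>R (v t \<omega> - p t \<omega>))) \<omega> = 0"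
    proof (rule bandit_gradient_cond_exp[where M = M, OF S filtr(2) pm[OF t] Ym[OF t] _ _ pmf])
      show "(\<lambda>\<omega>. a t *\<^sub>R (v t \<omega> - p t \<omega>)) \<in> borel_measurable (H t)"
        using vm[of t] pm[OF t] t by auto
      show "I t \<in> measurable S (count_space UNIV)"
        using measurable_from_subalg[OF filtr(2) Im[OF t]] .
      show "norm (a t *\<^sub>R (v t \<omega> - p t \<omega>)) \<le> a t * R" if "\<omega> \<in> space S" for \<omega>
        using a[OF t] P_diam(1)[OF pP[OF t that] vP[of t \<omega>]] by simp
    qed (use pP[OF t] P_ge P_mass f_le t in \<open>auto simp: Y_def\<close>)
    then show "AE \<omega> in S. real_cond_exp S (H t) (d t) \<omega> = 0"
      by (simp add: d_def[abs_def] g_def inner_diff_left right_diff_distrib)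
  qed (use T \<Omega> in auto)
  have dev: "sqrt (2 * \<Omega> * (\<Sum>t=1..T. (a t * L * R)\<^sup>2)) = R * L * sqrt (2 * \<Omega> * A)"
  proof -
    have "2 * \<Omega> * (\<Sum>t=1..T. (a t * L * R)\<^sup>2) = (R * L)\<^sup>2 * (2 * \<Omega> * A)"
      by (simp add: A_def sum_distrib_left power_mult_distrib mult_ac)
    moreover have "sqrt ((R * L)\<^sup>2) = R * L"
      using L P_diam(2) by simp
    ultimately show ?thesis
      by (simp only: real_sqrt_mult[of "(R * L)\<^sup>2"])
  qed
  have "{\<omega> \<in> space S. (\<Sum>t=1..T. d t \<omega>) \<le> R * L * sqrt (2 * \<Omega> * A)} \<subseteq>
    {\<omega> \<in> space S. \<forall>q\<in>P. (\<Sum>t=1..T. a t * (f (x t \<omega>) \<bullet> (q - p t \<omega>))) \<le> R\<^sup>2 + L\<^sup>2 * A + R * L * sqrt (2 * \<Omega> * A)}"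
  proof safe
    fix \<omega> q assume \<omega>: "\<omega> \<in> space S" and q: "q \<in> P"
      and d: "(\<Sum>t=1..T. d t \<omega>) \<le> R * L * sqrt (2 * \<Omega> * A)"
    have "(\<Sum>t=1..T. (a t *\<^sub>R Y t \<omega>) \<bullet> (q - p t \<omega>))
      \<le> ((norm (q - p 1 \<omega>))\<^sup>2 + (norm (q - v 1 \<omega>))\<^sup>2) / 2
      + (\<Sum>t=1..T. (norm (a t *\<^sub>R g t \<omega>))\<^sup>2 + (norm (a t *\<^sub>R Y t \<omega> - a t *\<^sub>R g t \<omega>))\<^sup>2) / 2
      + (\<Sum>t=1..T. d t \<omega>)"
      unfolding d_def
    proof (rule ghost_iterate_regret[where p = "\<lambda>t. p t \<omega>" and v = "\<lambda>t. v t \<omega>"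
          and u = "\<lambda>t. a t *\<^sub>R g t \<omega>" and z = "\<lambda>t. a t *\<^sub>R Y t \<omega>", OF P q T])
      fix t assume "t \<in> {1..<T}"
      then show "p (Suc t) \<omega> = closest_point P (p t \<omega> + a t *\<^sub>R g t \<omega>)"
        using bmd \<omega> unfolding g_def Y_def
        by (intro is_bandit_update_closest_point[OF P]) (auto simp: bandit_mirror_descent_def)
    qed (rule v_Suc)
    moreover have "(norm (q - p 1 \<omega>))\<^sup>2 \<le> R\<^sup>2" "(norm (q - v 1 \<omega>))\<^sup>2 \<le> R\<^sup>2"
      unfolding p1(2)[OF \<omega>] v1 using P_diam(1)[OF p1(1) q] by (auto intro!: power_mono)
    moreover have "(\<Sum>t=1..T. (norm (a t *\<^sub>R g t \<omega>))\<^sup>2 + (norm (a t *\<^sub>R Y t \<omega> - a t *\<^sub>R g t \<omega>))\<^sup>2)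
        \<le> (\<Sum>t=1..T. (a t * L)\<^sup>2 + (a t * L)\<^sup>2)"
      using uL[OF _ \<omega>] by (intro sum_mono add_mono power_mono) auto
    moreover have "(\<Sum>t=1..T. (a t * L)\<^sup>2 + (a t * L)\<^sup>2) = 2 * (L\<^sup>2 * A)"
      by (simp add: A_def sum_distrib_left power_mult_distrib mult_ac)
    ultimately have "(\<Sum>t=1..T. (a t *\<^sub>R Y t \<omega>) \<bullet> (q - p t \<omega>)) \<le> R\<^sup>2 + L\<^sup>2 * A + R * L * sqrt (2 * \<Omega> * A)"
      using d by (simp add: add_divide_distrib)
    then show "(\<Sum>t=1..T. a t * (f (x t \<omega>) \<bullet> (q - p t \<omega>))) \<le> R\<^sup>2 + L\<^sup>2 * A + R * L * sqrt (2 * \<Omega> * A)"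
      by (simp add: Y_def)
  qed
  from finite_measure_mono[OF this bandit_mirror_descent_event_measurable[OF filtr P f bmd]] tail
  show ?thesis
    unfolding dev by simp
qed

section \<open>Regret over the ambiguity set\<close>

text \<open>This replaces the supremum by a statement for each comparator. A nonempty bounded set is essential, since
  only then is the supremum of reals meaningful.\<close>

lemma weighted_regret_le_iff:
  fixes P :: "(real ^ 'n::finite) set"
  assumes P: "P \<noteq> {}" "bounded P" and A: "0 < (\<Sum>t=1..T. \<alpha> t)"
  shows "weighted_regret P f (normalized_weight \<alpha> T) T x p \<le> b \<longleftrightarrow>
    (\<forall>q\<in>P. (\<Sum>t=1..T. \<alpha> t * (f (x t) \<bullet> (q - p t))) \<le> b * (\<Sum>t=1..T. \<alpha> t))"
proof -
  let ?A = "\<Sum>t=1..T. \<alpha> t" and ?\<theta> = "normalized_weight \<alpha> T"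
  obtain B where B: "\<And>q. q \<in> P \<Longrightarrow> norm q \<le> B"
    using P(2) by (auto simp: bounded_iff)
  define z where "z = (\<Sum>t=1..T. ?\<theta> t *\<^sub>R f (x t))"
  have z: "(\<Sum>t=1..T. ?\<theta> t * (q \<bullet> f (x t))) = q \<bullet> z" for q
    by (simp add: z_def inner_sum_right)
  have bdd: "bdd_above ((\<lambda>q. q \<bullet> z) ` P)"
  proof (rule bdd_aboveI2)
    show "q \<bullet> z \<le> B * norm z" if "q \<in> P" for q
      using B[OF that] by (intro order_trans[OF norm_cauchy_schwarz] mult_right_mono) auto
  qed
  have scale: "q \<bullet> z - (\<Sum>t=1..T. ?\<theta> t * (p t \<bullet> f (x t))) = (\<Sum>t=1..T. \<alpha> t * (f (x t) \<bullet> (q - p t))) / ?A" for q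
    unfolding z[symmetric] sum_subtractf[symmetric] sum_divide_distrib
    by (intro sum.cong refl) (simp add: normalized_weight_def inner_diff_right inner_commute diff_divide_distrib right_diff_distrib)
  have "weighted_regret P f ?\<theta> T x p \<le> b \<longleftrightarrow> (SUP q\<in>P. q \<bullet> z) \<le> b + (\<Sum>t=1..T. ?\<theta> t * (p t \<bullet> f (x t)))"
    unfolding weighted_regret_def z by auto
  also have "\<dots> \<longleftrightarrow> (\<forall>q\<in>P. q \<bullet> z \<le> b + (\<Sum>t=1..T. ?\<theta> t * (p t \<bullet> f (x t))))"
    using P(1) bdd by (rule cSUP_le_iff)
  also have "\<dots> \<longleftrightarrow> (\<forall>q\<in>P. (\<Sum>t=1..T. \<alpha> t * (f (x t) \<bullet> (q - p t))) / ?A \<le> b)"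
    unfolding scale[symmetric] by (auto simp: algebra_simps)
  finally show ?thesis
    using A by (simp add: pos_divide_le_eq)
qed

lemma norm_le_sqrt_card:
  fixes y :: "real ^ 'n::finite"
  assumes "\<And>r. \<bar>y $ r\<bar> \<le> M"
  shows "norm y \<le> sqrt (real CARD('n)) * M"
proof -
  have M: "0 \<le> M" using assms[of undefined] by linarith
  have "(y $ r)\<^sup>2 \<le> M\<^sup>2" for r
    using assms[of r] M by (simp add: abs_le_square_iff[symmetric])
  then have "(\<Sum>r\<in>UNIV. (y $ r)\<^sup>2) \<le> real CARD('n) * M\<^sup>2"
    using sum_mono[of UNIV "\<lambda>r. (y $ r)\<^sup>2" "\<lambda>_. M\<^sup>2"] by simp
  moreover have "(norm y)\<^sup>2 = (\<Sum>r\<in>UNIV. (y $ r)\<^sup>2)"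
    unfolding power2_norm_eq_inner inner_vec_def by (simp only: power2_eq_square inner_real_def)
  ultimately have "(norm y)\<^sup>2 \<le> (sqrt (real CARD('n)) * M)\<^sup>2"
    by (simp add: power_mult_distrib)
  then show ?thesis
    by (rule power2_le_imp_le) (simp add: M)
qed

text \<open>From \<open>ln 2 \<ge> 2/3\<close>: up to \<open>4\<close> the left side is at most \<open>2 \<le> 3 ln 2\<close>, and up to \<open>16\<close> it is at most
  \<open>4 \<le> 3 ln 4\<close>.\<close>

lemma sqrt_le_3_ln:
  assumes "2 \<le> T" "T \<le> 16"
  shows "sqrt (real T) \<le> 3 * ln (real T)"
proof (cases "T \<le> 4")
  case True
  have "sqrt (real T) \<le> sqrt (2\<^sup>2)"
    using True by (intro real_sqrt_le_mono) simp
  also have "\<dots> \<le> 3 * ln 2"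
    using ln2_ge_two_thirds by simp
  also have "\<dots> \<le> 3 * ln (real T)"
    using assms by simp
  finally show ?thesis .
next
  case False
  have "sqrt (real T) \<le> sqrt (4\<^sup>2)"
    using assms by (intro real_sqrt_le_mono) simp
  also have "\<dots> \<le> 3 * (2 * ln 2)"
    using ln2_ge_two_thirds by simp
  also have "2 * ln 2 = ln (4 :: real)"
    using ln_realpow[of 2 2] by simp
  also have "3 * ln 4 \<le> 3 * ln (real T)"
    using False by simp
  finally show ?thesis .
qed

text \<open>With \<open>h \<le> 1 + ln T\<close> and \<open>8 \<surd>h \<le> 2 h + 8\<close> the left side is at most \<open>22 + 6 ln T\<close>, so \<open>ln T \<ge> 2.2\<close>
  suffices; \<open>T \<ge> 16\<close> gives \<open>8/3\<close>.\<close>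

lemma harmonic_terms_le:
  assumes "16 \<le> T" and h: "h = (\<Sum>t=1..T. 1 / real t)"
  shows "8 + 4 * h + 8 * sqrt h \<le> 16 * ln (real T)"
proof -
  have h0: "0 \<le> h" unfolding h by (intro sum_nonneg) auto
  have "harm T - ln (real T) \<le> harm 1 - ln (real 1)"
    by (rule euler_mascheroni_sequence_decreasing) (use assms in auto)
  then have hl: "h \<le> 1 + ln (real T)"
    by (simp add: h harm_def inverse_eq_divide)
  have "ln (2 ^ 4) \<le> ln (real T)"
    using assms by simp
  then have l: "8 / 3 \<le> ln (real T)"
    using ln2_ge_two_thirds ln_realpow[of 2 4] by simp
  have "0 \<le> (sqrt h - 2)\<^sup>2" by simp
  then have "4 * sqrt h \<le> h + 4"
    using h0 by (simp add: power2_diff)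
  then show ?thesis using hl l by linarith
qed

lemma sqrt_le_sum_inverse_sqrt: "sqrt (real T) \<le> (\<Sum>t=1..T. 1 / sqrt (real t))"
proof -
  have "sqrt (real T) = (\<Sum>t=1..T. 1 / sqrt (real T))"
    by (simp add: real_div_sqrt)
  also have "\<dots> \<le> (\<Sum>t=1..T. 1 / sqrt (real t))"
    by (intro sum_mono divide_left_mono) auto
  finally show ?thesis .
qed

text \<open>The constant \<open>c\<close> is chosen so that \<open>L c = (2 / N) \<surd>(\<rho> / \<Omega>)\<close>: then \<open>\<Omega>\<close> cancels from the deviation term and
  from the claimed bound, the quadratic term only gains from \<open>\<Omega> \<ge> 1\<close>, and everything becomes a
  multiple of \<open>\<rho> / N\<^sup>2\<close>.\<close>

lemma tuned_regret_bound_le: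
  fixes N \<rho> \<delta> \<Omega> C M :: real
  assumes pos: "0 < N" "0 < \<rho>" "0 < \<delta>" "0 < C" "0 < M" and \<Omega>: "1 \<le> \<Omega>" and T: "16 \<le> T"
  defines "c \<equiv> 2 * \<delta> / (C * M * N\<^sup>2) * sqrt (\<rho> / \<Omega>)"
    and "R \<equiv> 2 * sqrt (2 * \<rho>) / N" and "L \<equiv> C * M / (\<delta> / N)"
  defines "A \<equiv> \<Sum>t=1..T. (c / sqrt (real t))\<^sup>2"
  shows "R\<^sup>2 + L\<^sup>2 * A + R * L * sqrt (2 * \<Omega> * A)
    \<le> 3 * sqrt \<Omega> * 2 * C * M * ln (real T) * sqrt (2 * \<rho>) / (\<delta> * sqrt (real T))
      * (\<Sum>t=1..T. c / sqrt (real t))"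
proof -
  define h where "h = (\<Sum>t=1..T. 1 / real t)"
  define l where "l = ln (real T)"
  have l0: "0 \<le> l" using T by (simp add: l_def)
  have h0: "0 \<le> h" unfolding h_def by (intro sum_nonneg) auto
  have c0: "0 \<le> c" using pos \<Omega> by (simp add: c_def)
  have L0: "0 \<le> L" using pos by (simp add: L_def)
  have A: "A = c\<^sup>2 * h"
    by (simp add: A_def h_def sum_distrib_left power_divide)
  have Lc: "L * c = 2 / N * sqrt (\<rho> / \<Omega>)"
    using pos by (simp add: L_def c_def power2_eq_square)
  have "R\<^sup>2 = \<rho> / N\<^sup>2 * 8"
    using pos by (simp add: R_def power_divide power_mult_distrib)
  moreover have "L\<^sup>2 * A \<le> \<rho> / N\<^sup>2 * (4 * h)"
  proof -
    have "L\<^sup>2 * A = (L * c)\<^sup>2 * h" by (simp add: A power_mult_distrib)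
    also have "(L * c)\<^sup>2 = 4 / N\<^sup>2 * (\<rho> / \<Omega>)"
      using pos \<Omega> unfolding Lc by (simp add: power_mult_distrib power_divide)
    also have "\<dots> * h \<le> 4 / N\<^sup>2 * \<rho> * h"
      using pos \<Omega> h0 by (intro mult_right_mono mult_left_mono) (auto simp: field_simps)
    finally show ?thesis by (simp add: mult_ac)
  qed
  moreover have "R * L * sqrt (2 * \<Omega> * A) = \<rho> / N\<^sup>2 * (8 * sqrt h)"
  proof -
    have "R * L * sqrt (2 * \<Omega> * A) = R * (L * c) * sqrt (2 * \<Omega> * h)"
      using c0 by (simp add: A real_sqrt_mult)
    also have "\<dots> = 4 / N\<^sup>2 * (sqrt (2 * \<rho>) * sqrt (\<rho> / \<Omega>) * sqrt (2 * \<Omega> * h))"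
      unfolding Lc R_def by (simp add: power2_eq_square)
    also have "sqrt (2 * \<rho>) * sqrt (\<rho> / \<Omega>) * sqrt (2 * \<Omega> * h) = sqrt ((2 * \<rho>)\<^sup>2 * h)"
      using \<Omega> by (simp add: real_sqrt_mult[symmetric] power2_eq_square)
    also have "\<dots> = 2 * \<rho> * sqrt h"
      using pos by (simp add: real_sqrt_mult)
    finally show ?thesis by simp
  qed
  ultimately have "R\<^sup>2 + L\<^sup>2 * A + R * L * sqrt (2 * \<Omega> * A) \<le> \<rho> / N\<^sup>2 * (8 + 4 * h + 8 * sqrt h)"
    by (simp only: distrib_left)
  also have "\<dots> \<le> \<rho> / N\<^sup>2 * (16 * l)"
    using harmonic_terms_le[OF T h_def] pos by (intro mult_left_mono) (auto simp: l_def)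
  also have "\<dots> \<le> \<rho> / N\<^sup>2 * (12 * sqrt 2 * l)"
  proof -
    have "4 / 3 \<le> sqrt (2 :: real)"
      by (rule real_le_rsqrt) (simp add: power2_eq_square)
    then show ?thesis
      using pos l0 by (intro mult_left_mono mult_right_mono) auto
  qed
  also have "\<dots> = 3 * sqrt \<Omega> * 2 * C * M * l * sqrt (2 * \<rho>) / (\<delta> * sqrt (real T)) * (c * sqrt (real T))"
  proof -
    have "sqrt (2 * \<rho>) * (sqrt \<Omega> * sqrt (\<rho> / \<Omega>)) = sqrt (2 * \<rho>\<^sup>2)"
      using \<Omega> by (simp add: real_sqrt_mult[symmetric] power2_eq_square)
    also have "\<dots> = sqrt 2 * \<rho>"
      using pos by (simp add: real_sqrt_mult)
    finally have *: "sqrt 2 * \<rho> = sqrt (2 * \<rho>) * (sqrt \<Omega> * sqrt (\<rho> / \<Omega>))" ..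
    have "\<rho> / N\<^sup>2 * (12 * sqrt 2 * l) = 12 * l / N\<^sup>2 * (sqrt 2 * \<rho>)" by simp
    also have "\<dots> = 3 * sqrt \<Omega> * 2 * C * M * l * sqrt (2 * \<rho>) / (\<delta> * sqrt (real T)) * (c * sqrt (real T))"
      unfolding * c_def using pos T by (simp add: field_simps)
    finally show ?thesis .
  qed
  also have "\<dots> \<le> 3 * sqrt \<Omega> * 2 * C * M * l * sqrt (2 * \<rho>) / (\<delta> * sqrt (real T)) * (\<Sum>t=1..T. c / sqrt (real t))"
  proof (rule mult_left_mono)
    show "c * sqrt (real T) \<le> (\<Sum>t=1..T. c / sqrt (real t))"
      using mult_left_mono[OF sqrt_le_sum_inverse_sqrt c0, of T] by (simp add: sum_distrib_left)
  qed (use pos \<Omega> l0 in auto)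
  finally show ?thesis by (simp add: l_def)
qed

text \<open>In each round, Cauchy-Schwarz with the diameter of the ambiguity set gives at most \<open>2 M \<surd>(2 \<rho>)\<close>, and the
  claimed bound is this number times \<open>3 ln T / \<surd>T\<close> and further factors that are at least one.\<close>

lemma short_horizon_regret_le:
  fixes P :: "(real ^ 'n::finite) set"
  assumes \<rho>: "0 < \<rho>" and T: "2 \<le> T" "T \<le> 16"
    and p: "\<And>t. t \<in> {1..T} \<Longrightarrow> p t \<in> ambiguity_set \<delta> \<rho>" and q: "q \<in> ambiguity_set \<delta> \<rho>"
    and y: "\<And>t r. t \<in> {1..T} \<Longrightarrow> \<bar>y t $ r\<bar> \<le> M" and M: "0 < M"
    and \<alpha>: "\<And>t. t \<in> {1..T} \<Longrightarrow> 0 \<le> \<alpha> t"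
    and k: "1 \<le> C" "1 \<le> \<Omega>" "0 < \<delta>" "\<delta> < 1"
  shows "(\<Sum>t=1..T. \<alpha> t * (y t \<bullet> (q - p t :: real ^ 'n)))
    \<le> 3 * sqrt \<Omega> * 2 * C * M * ln (real T) * sqrt (2 * \<rho>) / (\<delta> * sqrt (real T)) * (\<Sum>t=1..T. \<alpha> t)"
proof -
  define N where "N = real CARD('n)"
  have "1 \<le> CARD('n)" by (simp add: Suc_le_eq)
  then have N: "1 \<le> N" by (simp add: N_def)
  define b where "b = 3 * sqrt \<Omega> * 2 * C * M * ln (real T) * sqrt (2 * \<rho>) / (\<delta> * sqrt (real T))"
  have "y t \<bullet> (q - p t) \<le> b" if t: "t \<in> {1..T}" for t
  proof -
    have "y t \<bullet> (q - p t) \<le> (sqrt N * M) * (2 * sqrt (2 * \<rho>) / N)"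
      using norm_le_sqrt_card[OF y[OF t]] ambiguity_set_diameter[OF \<rho> p[OF t] q] M
      by (intro order_trans[OF norm_cauchy_schwarz] mult_mono) (auto simp: N_def)
    also have "\<dots> = 2 * M * sqrt (2 * \<rho>) * (1 / sqrt N)"
      using N by (simp add: real_div_sqrt field_simps)
    also have "\<dots> \<le> 2 * M * sqrt (2 * \<rho>) * (3 * ln (real T) / sqrt (real T) * (sqrt \<Omega> * C / \<delta>))"
    proof (rule mult_left_mono)
      have "1 / sqrt N \<le> 1 * 1" using N by simp
      also have "1 \<le> sqrt \<Omega> * C" using k mult_mono[of 1 "sqrt \<Omega>" 1 C] by simp
      then have "1 * 1 \<le> 3 * ln (real T) / sqrt (real T) * (sqrt \<Omega> * C / \<delta>)"
        using sqrt_le_3_ln[OF T] T k by (intro mult_mono) (auto simp: le_divide_eq)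
      finally show "1 / sqrt N \<le> 3 * ln (real T) / sqrt (real T) * (sqrt \<Omega> * C / \<delta>)" .
    qed (use M \<rho> in auto)
    also have "\<dots> = b" by (simp add: b_def mult_ac)
    finally show ?thesis .
  qed
  then have "(\<Sum>t=1..T. \<alpha> t * (y t \<bullet> (q - p t))) \<le> (\<Sum>t=1..T. \<alpha> t * b)"
    using \<alpha> by (intro sum_mono mult_left_mono) auto
  also have "\<dots> = b * (\<Sum>t=1..T. \<alpha> t)"
    by (simp add: sum_distrib_left mult.commute)
  finally show ?thesis by (simp only: b_def)
qed

theorem proposition2:
  fixes X :: "(real ^ 'd::finite) set"
    and F :: "nat \<Rightarrow> 'n::finite \<Rightarrow> real ^ 'd \<Rightarrow> real"
    and M c\<^sub>p :: "nat \<Rightarrow> real"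
    and G \<rho> \<delta> \<Omega> C\<^sub>g :: real
    and w :: "real \<Rightarrow> real"
    and m n T :: nat
    and S :: "'w measure"
    and H :: "nat \<Rightarrow> 'w measure"
    and x :: "nat \<Rightarrow> 'w \<Rightarrow> real ^ 'd"
    and I :: "nat \<Rightarrow> nat \<Rightarrow> 'w \<Rightarrow> 'n"
    and P :: "nat \<Rightarrow> (real ^ 'n) set"
    and p :: "nat \<Rightarrow> nat \<Rightarrow> 'w \<Rightarrow> real ^ 'n"
    and \<alpha> \<theta> :: "nat \<Rightarrow> nat \<Rightarrow> real"
    and Fvec :: "nat \<Rightarrow> real ^ 'd \<Rightarrow> real ^ 'n"
  assumes n: "n = CARD('n)"
    and X: "closed X" "convex X"
    and F_convex: "\<And>i r. i \<in> {1..m} \<Longrightarrow> convex_on X (F i r)"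
    and F_lipschitz: "\<And>i r. i \<in> {1..m} \<Longrightarrow> G-lipschitz_on X (F i r)"
    and M_pos: "\<And>i. i \<in> {1..m} \<Longrightarrow> M i > 0"
    and F_bound: "\<And>i r y. i \<in> {1..m} \<Longrightarrow> y \<in> X \<Longrightarrow> \<bar>F i r y\<bar> \<le> M i"
    and Fvec: "\<And>i y. Fvec i y = (\<chi> r. F i r y)"
    and \<rho>: "0 < \<rho>" "\<rho> < 1"
    and \<delta>: "0 < \<delta>" "\<delta> < 1"
    and C\<^sub>g: "C\<^sub>g = 1 + sqrt (2 * \<rho> / real n)"
    and \<Omega>: "\<Omega> \<ge> 1"
    and w: "\<And>u. w u = 3 * sqrt u"
    and T: "T \<ge> 2"
    and P: "\<And>i. i \<in> {1..m} \<Longrightarrow> P i = ambiguity_set \<delta> \<rho>"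
    and c\<^sub>p: "\<And>i. c\<^sub>p i = 2 * \<delta> / (C\<^sub>g * M i * (real n)\<^sup>2) * sqrt (\<rho> / \<Omega>)"
    and \<alpha>: "\<And>i t. \<alpha> i t = c\<^sub>p i / sqrt (real t)"
    and \<theta>: "\<And>i t. \<theta> i t = normalized_weight (\<alpha> i) T t"
    and prob: "prob_space S"
    and filtr: "filtration (space S) H" "\<And>t. subalgebra S (H t)"
    and x_meas: "\<And>t. t \<in> {1..T} \<Longrightarrow> x t \<in> borel_measurable (H t)"
    and x_in: "\<And>t \<omega>. t \<in> {1..T} \<Longrightarrow> \<omega> \<in> space S \<Longrightarrow> x t \<omega> \<in> X"
    and bmd: "\<And>i. i \<in> {1..m} \<Longrightarrow>
      bandit_mirror_descent S H (P i) (Fvec i) (\<alpha> i) T x (I i) (p i)"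
  shows "\<forall>i\<in>{1..m}.
    measure S {\<omega> \<in> space S.
        weighted_regret (P i) (Fvec i) (\<theta> i) T (\<lambda>t. x t \<omega>) (\<lambda>t. p i t \<omega>)
          \<le> w \<Omega> * 2 * C\<^sub>g * M i * ln (real T) * sqrt (2 * \<rho>) / (\<delta> * sqrt (real T))}
      \<ge> 1 - 2 * exp (- \<Omega>)"
proof
  fix i assume i: "i \<in> {1..m}"
  interpret prob_space S by fact
  interpret filtration "space S" H by (rule filtr)
  define Q where "Q = (ambiguity_set \<delta> \<rho> :: (real ^ 'n) set)"
  note bmd_i = bmd[OF i, unfolded P[OF i], folded Q_def]
  have Q: "convex Q" "closed Q"
    using convex_ambiguity_set[OF \<rho>(1)] closed_ambiguity_set[OF \<rho>(1)] by (auto simp: Q_def)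
  have "Q \<noteq> {}"
    using bmd_i by (auto simp: bandit_mirror_descent_def)
  have "bounded Q"
    unfolding Q_def ambiguity_set_eq[OF \<rho>(1)] by (intro bounded_Int) auto
  have Cg: "1 \<le> C\<^sub>g" using \<rho> by (simp add: C\<^sub>g)
  have n0: "0 < real n" by (simp add: n)
  have c: "0 < c\<^sub>p i"
    using \<delta> \<rho> \<Omega> Cg M_pos[OF i] n0 unfolding c\<^sub>p by (intro mult_pos_pos divide_pos_pos) auto
  have \<alpha>_pos: "0 < \<alpha> i t" if "t \<in> {1..T}" for t
    using that c by (simp add: \<alpha>)
  have \<alpha>_sum: "0 < (\<Sum>t=1..T. \<alpha> i t)"
    using \<alpha>_pos T by (intro sum_pos) auto
  have \<theta>_eq: "\<theta> i = normalized_weight (\<alpha> i) T"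
    using \<theta> by auto
  define b where "b = 3 * sqrt \<Omega> * 2 * C\<^sub>g * M i * ln (real T) * sqrt (2 * \<rho>) / (\<delta> * sqrt (real T))"
  let ?E = "\<lambda>k. {\<omega> \<in> space S. \<forall>q\<in>Q. (\<Sum>t=1..T. \<alpha> i t * (Fvec i (x t \<omega>) \<bullet> (q - p i t \<omega>))) \<le> k}"
  have event: "{\<omega> \<in> space S. weighted_regret (P i) (Fvec i) (\<theta> i) T (\<lambda>t. x t \<omega>) (\<lambda>t. p i t \<omega>)
      \<le> w \<Omega> * 2 * C\<^sub>g * M i * ln (real T) * sqrt (2 * \<rho>) / (\<delta> * sqrt (real T))} = ?E (b * (\<Sum>t=1..T. \<alpha> i t))"
    unfolding \<theta>_eq P[OF i] Q_def[symmetric] w b_def[symmetric]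
      weighted_regret_le_iff[OF \<open>Q \<noteq> {}\<close> \<open>bounded Q\<close> \<alpha>_sum] ..
  have F_le: "\<bar>Fvec i (x t \<omega>) $ r\<bar> \<le> M i" if "t \<in> {1..T}" "\<omega> \<in> space S" for t \<omega> r
    using F_bound[OF i x_in[OF that]] by (simp add: Fvec)
  have F_cont: "continuous_on X (Fvec i)"
    unfolding Fvec using F_lipschitz[OF i]
    by (intro continuous_on_vec_lambda lipschitz_on_continuous_on) auto
  have F_meas: "(\<lambda>\<omega>. Fvec i (x t \<omega>)) \<in> borel_measurable (H t)" if "t \<in> {1..T}" for t
  proof (rule measurable_compose[OF _ borel_measurable_continuous_on_restrict[OF F_cont]])
    show "x t \<in> measurable (H t) (restrict_space borel X)"
      using x_in[OF that] space_F by (intro measurable_restrict_space2 x_meas[OF that]) auto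
  qed
  have meas: "?E k \<in> sets S" for k
    using F_meas by (rule bandit_mirror_descent_event_measurable[OF filtr Q _ bmd_i])
  have "1 - exp (- \<Omega>) \<le> measure S (?E (b * (\<Sum>t=1..T. \<alpha> i t)))"
  proof (cases "T \<le> 16")
    case True
    have "?E (b * (\<Sum>t=1..T. \<alpha> i t)) = space S"
    proof safe
      fix \<omega> q assume \<omega>: "\<omega> \<in> space S" and q: "q \<in> Q"
      show "(\<Sum>t=1..T. \<alpha> i t * (Fvec i (x t \<omega>) \<bullet> (q - p i t \<omega>))) \<le> b * (\<Sum>t=1..T. \<alpha> i t)"
        unfolding b_def
      proof (rule short_horizon_regret_le[OF \<rho>(1) T True _ _ F_le[OF _ \<omega>] M_pos[OF i] _ Cg \<Omega> \<delta>])
        show "p i t \<omega> \<in> ambiguity_set \<delta> \<rho>" if "t \<in> {1..T}" for t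
          using bandit_mirror_descent_adapted(2)[OF filtr(1) Q F_meas bmd_i _ _ \<omega>] that by (auto simp: Q_def)
      qed (use q \<alpha>_pos in \<open>auto simp: Q_def less_imp_le\<close>)
    qed
    then show ?thesis by (simp add: prob_space)
  next
    case False
    define R where "R = 2 * sqrt (2 * \<rho>) / real n"
    define L where "L = C\<^sub>g * M i / (\<delta> / real n)"
    define A where "A = (\<Sum>t=1..T. (\<alpha> i t)\<^sup>2)"
    have "1 - exp (- \<Omega>) \<le> measure S (?E (R\<^sup>2 + L\<^sup>2 * A + R * L * sqrt (2 * \<Omega> * A)))"
      unfolding L_def A_def
    proof (rule bandit_mirror_descent_concentration[OF prob filtr Q _ _ _ _ _ F_meas F_le M_pos[OF i] \<alpha>_pos _ _ bmd_i])
      show "0 < \<delta> / real n" using \<delta> n0 by simp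
      show "0 < R" using \<rho> n0 by (simp add: R_def)
      show "\<delta> / real n \<le> q $ r" if "q \<in> Q" for q r
        using that by (simp add: Q_def ambiguity_set_def n)
      show "1 \<bullet> q \<le> C\<^sub>g" if "q \<in> Q" for q
        using ambiguity_set_mass[OF \<rho>(1)] that by (simp add: Q_def C\<^sub>g n)
      show "norm (q' - q) \<le> R" if "q \<in> Q" "q' \<in> Q" for q q'
        using ambiguity_set_diameter[OF \<rho>(1)] that by (simp add: Q_def R_def n)
    qed (use T \<Omega> in auto)
    moreover have "R\<^sup>2 + L\<^sup>2 * A + R * L * sqrt (2 * \<Omega> * A) \<le> b * (\<Sum>t=1..T. \<alpha> i t)"
      unfolding R_def L_def A_def b_def \<alpha> c\<^sub>p
      using False \<rho> \<delta> \<Omega> Cg M_pos[OF i] n0 by (intro tuned_regret_bound_le) auto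
    then have "measure S (?E (R\<^sup>2 + L\<^sup>2 * A + R * L * sqrt (2 * \<Omega> * A))) \<le> measure S (?E (b * (\<Sum>t=1..T. \<alpha> i t)))"
      by (intro finite_measure_mono meas) (auto intro: order_trans)
    ultimately show ?thesis by linarith
  qed
  moreover have "0 \<le> exp (- \<Omega>)" by simp
  ultimately show "1 - 2 * exp (- \<Omega>) \<le> measure S {\<omega> \<in> space S.
      weighted_regret (P i) (Fvec i) (\<theta> i) T (\<lambda>t. x t \<omega>) (\<lambda>t. p i t \<omega>)
        \<le> w \<Omega> * 2 * C\<^sub>g * M i * ln (real T) * sqrt (2 * \<rho>) / (\<delta> * sqrt (real T))}"
    unfolding event by linarith
qed

end
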